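(* Let the setting and 3DVAR iterates be as described in the context, and assume: (1) $\Sigma$ and $A^*A$ are simultaneously diagonalized by an orthonormal basis $\{\varphi_i\}_{i\ge1}$ of $X$, with respective eigenvalues $\sigma_i$ and $a_i^2$ satisfying $\sigma_i\asymp i^{-1-2\epsilon}$ and $a_i\asymp i^{-p}$ for some $\epsilon>0$, $p>0$; (2) for some $\beta\ge0$, $\sum_{i=1}^\infty i^{2\beta}|u_{0,i}-u_i^\dagger|^2<\infty$. Fix $t\ge0$ and set $$\bar\tau_{\rm b}=\frac{t(1+2\epsilon)+2\beta}{2(1+2\epsilon+2p)},\qquad\bar\tau_{\rm v}=\frac{t(1+2\epsilon)+2\epsilon}{1+2\epsilon+2p}.$$ (i) If $\bar\tau_{\rm b},\bar\tau_{\rm v}\le1$, then for every $\theta\in(0,1]$ and $n\ge1$, with the optimal choice of $\alpha$ (that is, for a suitable $\alpha=\alpha(n,\theta)>0$), $$\mathbb{E}\left[\|\bar u_n-u^\dagger\|_t^2\right]\lesssim\theta^{-\frac{2\beta+t(1+2\epsilon)}{1+2p+2\beta+\theta[t(1+2\epsilon)+2\epsilon]}}\,n^{-\frac{t(1+2\epsilon)+2\beta}{1+2p+2\beta+\theta[t(1+2\epsilon)+2\epsilon]}}.$$ (ii) If $\bar\tau_{\rm b},\bar\tau_{\rm v}>1$, then for every $n\ge1$, with the optimal choice of $\alpha$ (that is, for a suitable $\alpha=\alpha(n)>0$), $$\mathbb{E}\left[\|\bar u_n-u^\dagger\|_t^2\right]\lesssim n^{-1}.$$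
   Context: $X,Y$ are separable Hilbert spaces, $A:X\to Y$ is a compact linear operator, $\Sigma$ is a self-adjoint positive definite operator on $X$, $u^\dagger\in X$, $\gamma>0$, and $\alpha>0$ is a regularization parameter. The noises $\eta_1,\eta_2,\dots$ are i.i.d. white noise $N(0,\gamma^2I)$ on $Y$ (cylindrical Gaussians when $\dim Y=\infty$, so $\mathbb{E}\|T\eta_k\|^2=\gamma^2\operatorname{Tr}(TT^* )$ for Hilbert–Schmidt $T$), and $y_k=Au^\dagger+\eta_k$. Norms: $\|x\|_t=\|\Sigma^{t/2}x\|$. Coordinates: $x_i=\langle x,\varphi_i\rangle$, $u_{0,i}=\langle u_0,\varphi_i\rangle$. 3DVAR with parameter $\alpha$: $u_0\in X$ is deterministic and $u_n=\mathcal{K}y_n+(I-\mathcal{K}A)u_{n-1}$ with $\mathcal{K}=(A^*A+\alpha\Sigma^{-1})^{-1}A^*$, i.e. $\mathcal{K}=\Sigma^{1/2}(\alpha I+B^*B)^{-1}B^*$ where $B=A\Sigma^{1/2}$. Iterate average: $\bar u_n=\frac1n\sum_{k=1}^nu_k$ (depending on $\alpha$). $a_i\asymp b_i$ means $c\,b_i\le a_i\le c'b_i$ for all $i$ with constants $c,c'>0$. $a\lesssim b$ means $a\le C'b$ with $C'$ independent of $n$ and $\theta$ (it may depend on $\gamma,A,\Sigma,u_0-u^\dagger$ and the indices $t,\beta,p,\epsilon$). *)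

theory Defs
  imports "HOL-Probability.Probability"
begin

definition compact_operator :: "('x::real_normed_vector \<Rightarrow> 'y::real_normed_vector) \<Rightarrow> bool" where
  "compact_operator A \<longleftrightarrow> linear A \<and> (\<forall>S. bounded S \<longrightarrow> compact (closure (A ` S)))"

definition self_adjoint_positive_definite :: "('x::real_inner \<Rightarrow> 'x) \<Rightarrow> bool" where
  "self_adjoint_positive_definite S \<longleftrightarrow> bounded_linear S \<and>
     (\<forall>x y. S x \<bullet> y = x \<bullet> S y) \<and> (\<forall>x. x \<noteq> 0 \<longrightarrow> S x \<bullet> x > 0)"

text \<open>All sequences indexed by \<open>i \<ge> 1\<close> in the mathematics are functions on \<open>nat\<close> whose value at
  \<open>0\<close> is never used; series over \<open>i \<ge> 1\<close> are written with \<open>Suc i\<close>.\<close>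

definition orthonormal_basis :: "(nat \<Rightarrow> 'x::real_inner) \<Rightarrow> bool" where
  "orthonormal_basis \<phi> \<longleftrightarrow>
     (\<forall>i\<ge>1. \<forall>j\<ge>1. \<phi> i \<bullet> \<phi> j = (if i = j then 1 else 0)) \<and>
     closure (span (\<phi> ` {1..})) = UNIV"

definition comparable :: "(nat \<Rightarrow> real) \<Rightarrow> (nat \<Rightarrow> real) \<Rightarrow> bool" where
  "comparable f g \<longleftrightarrow> (\<exists>c>0. \<exists>c'>0. \<forall>i\<ge>1. c * g i \<le> f i \<and> f i \<le> c' * g i)"

text \<open>For an operator \<open>S\<close> with \<open>S (\<phi> i) = \<sigma> i *\<^sub>R \<phi> i\<close>, where \<open>\<phi>\<close> is an orthonormal basis and
  \<open>\<sigma> i > 0\<close>, this is the power \<open>S\<^sup>s\<close> in the sense of the spectral calculus.\<close>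

definition spectral_power :: "(nat \<Rightarrow> 'x::real_inner) \<Rightarrow> (nat \<Rightarrow> real) \<Rightarrow> real \<Rightarrow> 'x \<Rightarrow> 'x" where
  "spectral_power \<phi> \<sigma> s x = (\<Sum>i. (\<sigma> (Suc i) powr s * (x \<bullet> \<phi> (Suc i))) *\<^sub>R \<phi> (Suc i))"

text \<open>A cylindrical random variable on \<open>'y\<close> is represented by its real-valued tests:
  \<open>Z y \<omega>\<close> stands for \<open>\<langle>Z(\<omega>), y\<rangle>\<close>. Almost sure linearity makes the family jointly Gaussian,
  with covariance \<open>\<gamma>\<^sup>2 * (y \<bullet> z)\<close>; the case \<open>y = 0\<close> is left out of the last clause because its law
  is a point mass, and linearity forces it.\<close>

definition white_noise :: "'w measure \<Rightarrow> real \<Rightarrow> ('y::real_inner \<Rightarrow> 'w \<Rightarrow> real) \<Rightarrow> bool" where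
  "white_noise M \<gamma> Z \<longleftrightarrow>
     (\<forall>y. Z y \<in> borel_measurable M) \<and>
     (\<forall>c y z. AE \<omega> in M. Z (c *\<^sub>R y + z) \<omega> = c * Z y \<omega> + Z z \<omega>) \<and>
     (\<forall>y. y \<noteq> 0 \<longrightarrow> distributed M lborel (Z y) (normal_density 0 (\<gamma> * norm y)))"

text \<open>Independence is that of the processes \<open>(\<eta> k y)\<^sub>y\<close>, \<open>k \<ge> 1\<close>, viewed as random elements of
  the product space. They are identically distributed because \<open>white_noise M \<gamma>\<close> fixes all
  finite-dimensional laws.\<close>

definition iid_white_noise ::
    "'w measure \<Rightarrow> real \<Rightarrow> (nat \<Rightarrow> 'y::real_inner \<Rightarrow> 'w \<Rightarrow> real) \<Rightarrow> bool" where
  "iid_white_noise M \<gamma> \<eta> \<longleftrightarrow> prob_space M \<and>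
     (\<forall>k\<ge>1. white_noise M \<gamma> (\<eta> k)) \<and>
     prob_space.indep_vars M (\<lambda>_. PiM UNIV (\<lambda>_. borel)) (\<lambda>k \<omega> y. \<eta> k y \<omega>) {1..}"

text \<open>Image of a cylindrical random variable \<open>Z\<close> on \<open>'y\<close> under an operator \<open>T\<close> that makes it a
  genuine random variable (\<open>T\<close> Hilbert--Schmidt if \<open>Z\<close> is shifted white noise): the \<open>'x\<close>-valued
  random variable, unique up to a null set, with \<open>\<langle>T Z, x\<rangle> = \<langle>Z, T\<^sup>* x\<rangle>\<close> almost surely for
  every \<open>x\<close>.\<close>

definition cylindrical_image ::
    "'w measure \<Rightarrow> ('y::real_inner \<Rightarrow> 'x::real_inner) \<Rightarrow> ('y \<Rightarrow> 'w \<Rightarrow> real) \<Rightarrow> 'w \<Rightarrow> 'x" where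
  "cylindrical_image M T Z = (SOME \<xi>. \<xi> \<in> borel_measurable M \<and>
     (\<forall>x. AE \<omega> in M. \<xi> \<omega> \<bullet> x = Z (adjoint T x) \<omega>))"

text \<open>The data \<open>y\<^sub>k = A u\<^sup>\<dagger> + \<eta>\<^sub>k\<close> as cylindrical random variables.\<close>

definition data :: "('x \<Rightarrow> 'y::real_inner) \<Rightarrow> 'x \<Rightarrow> (nat \<Rightarrow> 'y \<Rightarrow> 'w \<Rightarrow> real) \<Rightarrow>
    nat \<Rightarrow> 'y \<Rightarrow> 'w \<Rightarrow> real" where
  "data A udag \<eta> k v \<omega> = A udag \<bullet> v + \<eta> k v \<omega>"

text \<open>The gain \<open>R (\<alpha> I + B\<^sup>* B)\<^sup>-\<^sup>1 B\<^sup>*\<close>, \<open>B = A R\<close>; here \<open>R\<close> is the square root of the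
  covariance operator.\<close>

definition gain :: "('x::real_inner \<Rightarrow> 'y::real_inner) \<Rightarrow> ('x \<Rightarrow> 'x) \<Rightarrow> real \<Rightarrow> 'y \<Rightarrow> 'x" where
  "gain A R \<alpha> = (let B = A \<circ> R in
     R \<circ> inv (\<lambda>x. \<alpha> *\<^sub>R x + adjoint B (B x)) \<circ> adjoint B)"

primrec threedvar :: "'w measure \<Rightarrow> ('x::real_inner \<Rightarrow> 'y::real_inner) \<Rightarrow> ('y \<Rightarrow> 'x) \<Rightarrow>
    (nat \<Rightarrow> 'y \<Rightarrow> 'w \<Rightarrow> real) \<Rightarrow> 'x \<Rightarrow> nat \<Rightarrow> 'w \<Rightarrow> 'x" where
  "threedvar M A K Y u0 0 = (\<lambda>\<omega>. u0)"
| "threedvar M A K Y u0 (Suc n) = (\<lambda>\<omega>. cylindrical_image M K (Y (Suc n)) \<omega> +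
     (threedvar M A K Y u0 n \<omega> - K (A (threedvar M A K Y u0 n \<omega>))))"

definition iterate_average :: "(nat \<Rightarrow> 'w \<Rightarrow> 'x::real_vector) \<Rightarrow> nat \<Rightarrow> 'w \<Rightarrow> 'x" where
  "iterate_average u n \<omega> = (1 / real n) *\<^sub>R (\<Sum>k=1..n. u k \<omega>)"

text \<open>The mean squared error in the norm \<open>\<parallel>\<cdot>\<parallel>\<^sub>t\<close> of the averaged 3DVAR iterates. It takes
  values in the extended nonnegative reals, so that a finite bound includes integrability.\<close>

definition mean_sq_error :: "'w measure \<Rightarrow> ('x::real_inner \<Rightarrow> 'y::real_inner) \<Rightarrow>
    (nat \<Rightarrow> 'x) \<Rightarrow> (nat \<Rightarrow> real) \<Rightarrow> (nat \<Rightarrow> 'y \<Rightarrow> 'w \<Rightarrow> real) \<Rightarrow>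
    'x \<Rightarrow> 'x \<Rightarrow> real \<Rightarrow> real \<Rightarrow> nat \<Rightarrow> ennreal" where
  "mean_sq_error M A \<phi> \<sigma> \<eta> u0 udag t \<alpha> n =
     (let K = gain A (spectral_power \<phi> \<sigma> (1/2)) \<alpha>;
          u = threedvar M A K (data A udag \<eta>) u0
      in \<integral>\<^sup>+\<omega>. ennreal ((norm (spectral_power \<phi> \<sigma> (t/2) (iterate_average u n \<omega> - udag)))\<^sup>2) \<partial>M)"

definition tau_b :: "real \<Rightarrow> real \<Rightarrow> real \<Rightarrow> real \<Rightarrow> real" where
  "tau_b \<epsilon> p \<beta> t = (t * (1 + 2*\<epsilon>) + 2*\<beta>) / (2 * (1 + 2*\<epsilon> + 2*p))"

definition tau_v :: "real \<Rightarrow> real \<Rightarrow> real \<Rightarrow> real" where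
  "tau_v \<epsilon> p t = (t * (1 + 2*\<epsilon>) + 2*\<epsilon>) / (1 + 2*\<epsilon> + 2*p)"

end

theory Submission
  imports Defs
begin

text \<open>In the eigenbasis the 3DVAR iteration decouples. Let \<open>\<lambda>\<^sub>i = \<sigma>\<^sub>i a\<^sub>i\<^sup>2\<close> be the eigenvalues of \<open>B\<^sup>*B\<close> and
  \<open>r\<^sub>i = \<alpha> / (\<alpha> + \<lambda>\<^sub>i)\<close>. The \<open>i\<close>-th coordinate of the error is multiplied by \<open>r\<^sub>i\<close> in each step and
  receives an independent centred Gaussian of variance \<open>\<gamma>\<^sup>2 (1 - r\<^sub>i)\<^sup>2 / a\<^sub>i\<^sup>2\<close>. Averaging turns the powers
  of \<open>r\<^sub>i\<close> into geometric sums, so the mean squared error is an explicit series, the content of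
  \<open>nn_integral_error\<close>. The analytic side of this reduction is Parseval's identity and the existence
  of adjoints in a space with an orthonormal basis; the probabilistic side is that a
  Hilbert--Schmidt image of white noise exists as a random vector (\<open>white_noise_series\<close>).

  Put \<open>N = n / \<alpha>\<close>. The geometric sums give, for the \<open>i\<close>-th coordinate, a squared bias of at most
  \<open>d\<^sub>i\<^sup>2 (min 1 (1 / (N \<lambda>\<^sub>i)))\<^sup>2\<close> and a variance of at most \<open>\<gamma>\<^sup>2 / (n a\<^sub>i\<^sup>2) (min 1 (N \<lambda>\<^sub>i))\<^sup>2\<close>. These are at most
  \<open>d\<^sub>i\<^sup>2 (N \<lambda>\<^sub>i)\<^sup>-\<^sup>2\<^sup>\<tau>\<close> and \<open>\<gamma>\<^sup>2 / (n a\<^sub>i\<^sup>2) (N \<lambda>\<^sub>i)\<^sup>x\<close> for any \<open>\<tau>, x \<in> [0, 1]\<close>. Let \<open>q = 1 + 2\<epsilon> + 2p\<close>, the decay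
  exponent of \<open>\<lambda>\<^sub>i\<close>, and \<open>T = t (1 + 2\<epsilon>)\<close>, that of \<open>\<sigma>\<^sub>i\<^sup>t\<close>. The smoothness assumption bounds the sum of the
  biases by a multiple of \<open>N\<^sup>-\<^sup>2\<^sup>\<tau>\<close> as soon as \<open>2 q \<tau> \<le> T + 2 \<beta>\<close>, and the variances sum to a multiple of
  \<open>N\<^sup>x / n (1 + 1 / \<delta>)\<close> when \<open>T - 2p + q x = 1 + \<delta>\<close> with \<open>\<delta> > 0\<close>. Together this is
  \<open>mean_sq_error_le\<close>.

  In the first regime one takes \<open>\<tau> = tau_b\<close> and \<open>\<delta> = \<theta> (T + 2\<epsilon>)\<close>, which forces
  \<open>x = 1 - (1 - \<theta>) tau_v\<close>; the two terms are then \<open>N\<^sup>-\<^sup>2\<^sup>\<tau>\<close> and \<open>N\<^sup>x / (n \<theta>)\<close> up to constants, and equating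
  them determines \<open>N\<close> and the rate. In the second regime the variances are summable even for
  \<open>x = 0\<close>, so the variance is of order \<open>1 / n\<close>, and the saturated bias \<open>N\<^sup>-\<^sup>2\<close> with \<open>N = n\<close> is smaller.\<close>

section \<open>Hilbert spaces with an orthonormal basis\<close>

text \<open>An orthonormal basis indexed from \<open>0\<close>. Density of the span makes the coordinates separate
  points (\<open>basis_ext\<close>), and vector identities are reduced to scalar ones in this way.\<close>

locale hilbert_basis =
  fixes e :: "nat \<Rightarrow> 'x::{real_inner,banach,second_countable_topology}"
  assumes inner_basis: "e i \<bullet> e j = (if i = j then 1 else 0)"
    and dense_span: "closure (span (range e)) = UNIV"
begin

lemma norm_sum_basis_sq:
  assumes "finite I"
  shows "(norm (\<Sum>i\<in>I. c i *\<^sub>R e i))\<^sup>2 = (\<Sum>i\<in>I. (c i)\<^sup>2)"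
  unfolding power2_norm_eq_inner using assms
  by (simp add: inner_sum_left inner_sum_right inner_basis power2_eq_square
      sum.delta if_distrib cong: if_cong)

lemma summable_basis:
  assumes "summable (\<lambda>i. (c i)\<^sup>2)"
  shows "summable (\<lambda>i. c i *\<^sub>R e i)"
  unfolding summable_Cauchy
proof (intro allI impI)
  fix \<delta> :: real assume "\<delta> > 0"
  then have "\<delta>\<^sup>2 > 0" by simp
  then obtain N where N: "\<And>m n. m \<ge> N \<Longrightarrow> norm (\<Sum>i\<in>{m..<n}. (c i)\<^sup>2) < \<delta>\<^sup>2"
    using assms unfolding summable_Cauchy by meson
  have "norm (\<Sum>i\<in>{m..<n}. c i *\<^sub>R e i) < \<delta>" if "m \<ge> N" for m n
  proof -
    have "(norm (\<Sum>i\<in>{m..<n}. c i *\<^sub>R e i))\<^sup>2 < \<delta>\<^sup>2"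
      using N[OF that, of n] by (simp add: norm_sum_basis_sq)
    then show ?thesis using \<open>\<delta> > 0\<close> power2_less_imp_less by fastforce
  qed
  then show "\<exists>N. \<forall>m\<ge>N. \<forall>n. norm (\<Sum>i\<in>{m..<n}. c i *\<^sub>R e i) < \<delta>" by blast
qed

lemma coord_of_sums:
  assumes "(\<lambda>i. c i *\<^sub>R e i) sums x"
  shows "x \<bullet> e j = c j"
proof -
  have "(\<lambda>i. (c i *\<^sub>R e i) \<bullet> e j) sums (x \<bullet> e j)"
    by (rule bounded_linear.sums[OF bounded_linear_inner_left assms])
  moreover have "(\<lambda>i. (c i *\<^sub>R e i) \<bullet> e j) = (\<lambda>i. if i = j then c i else 0)"
    by (auto simp: inner_basis)
  ultimately show ?thesis using sums_single[of j c] sums_unique2 by metis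
qed

lemma coord_suminf:
  "summable (\<lambda>i. (c i)\<^sup>2) \<Longrightarrow> (\<Sum>i. c i *\<^sub>R e i) \<bullet> e j = c j"
  by (rule coord_of_sums) (simp add: summable_basis summable_sums)

lemma basis_ext:
  assumes "\<And>i. x \<bullet> e i = y \<bullet> e i"
  shows "x = y"
proof -
  let ?Z = "{z. (x - y) \<bullet> z = 0}"
  have "closed ?Z" by (rule closed_hyperplane)
  have "subspace ?Z" by (simp add: subspace_hyperplane)
  have "range e \<subseteq> ?Z" using assms by (auto simp: inner_diff_left)
  then have "span (range e) \<subseteq> ?Z" using \<open>subspace ?Z\<close> by (rule span_minimal)
  then have "closure (span (range e)) \<subseteq> ?Z" using \<open>closed ?Z\<close> by (rule closure_minimal)
  then have "x - y \<in> ?Z" using dense_span by blast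
  then show ?thesis by simp
qed

text \<open>Testing a bounded functional on the finite sum of the \<open>f (e i) *\<^sub>R e i\<close> bounds the sum of
  squares by the square of the norm of the functional.\<close>

lemma summable_functional_sq:
  assumes "bounded_linear (f :: 'x \<Rightarrow> real)"
  shows "summable (\<lambda>i. (f (e i))\<^sup>2)"
proof -
  interpret f: bounded_linear f by fact
  obtain K where K: "\<And>x. norm (f x) \<le> norm x * K" "K > 0" using f.pos_bounded by blast
  have "(\<Sum>i<n. (f (e i))\<^sup>2) \<le> K\<^sup>2" for n
  proof -
    let ?s = "\<Sum>i<n. f (e i) *\<^sub>R e i"
    have nn: "(norm ?s)\<^sup>2 = (\<Sum>i<n. (f (e i))\<^sup>2)" by (rule norm_sum_basis_sq) simp
    have "f ?s = (norm ?s)\<^sup>2"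
      unfolding nn by (simp add: f.sum f.scaleR power2_eq_square)
    then have "norm ?s * norm ?s \<le> norm ?s * K"
      using K(1)[of ?s] by (simp add: power2_eq_square)
    then have "norm ?s \<le> K" using K(2) by (cases "norm ?s = 0") auto
    then have "(norm ?s)\<^sup>2 \<le> K\<^sup>2" by (simp add: power_mono)
    with nn show ?thesis by simp
  qed
  then show ?thesis
    by (intro bounded_imp_summable[where B="K\<^sup>2"]) (auto simp: lessThan_Suc_atMost[symmetric] simp del: sum.lessThan_Suc)
qed

lemma summable_coord_sq: "summable (\<lambda>i. (x \<bullet> e i)\<^sup>2)"
  by (rule summable_functional_sq) (rule bounded_linear_inner_right)

lemma basis_expansion: "(\<lambda>i. (x \<bullet> e i) *\<^sub>R e i) sums x"
proof -
  have "(\<Sum>i. (x \<bullet> e i) *\<^sub>R e i) = x"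
    by (rule basis_ext) (simp add: coord_suminf summable_coord_sq)
  then show ?thesis
    using summable_sums[OF summable_basis[OF summable_coord_sq[of x]]] by simp
qed

lemma Parseval: "(\<lambda>i. (x \<bullet> e i) * (y \<bullet> e i)) sums (x \<bullet> y)"
  using bounded_linear.sums[OF bounded_linear_inner_left basis_expansion, of x y]
  by (simp add: inner_commute)

lemma Parseval_norm: "(\<lambda>i. (x \<bullet> e i)\<^sup>2) sums (norm x)\<^sup>2"
  using Parseval[of x x] by (simp add: power2_norm_eq_inner flip: power2_eq_square)

text \<open>This makes \<open>adjoint A\<close>, which is defined by a choice, an actual adjoint for every bounded operator
  on the space, although the space is infinite dimensional.\<close>

lemma Riesz:
  assumes "bounded_linear (f :: 'x \<Rightarrow> real)"
  shows "\<exists>z. \<forall>x. f x = x \<bullet> z"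
proof -
  interpret f: bounded_linear f by fact
  let ?z = "\<Sum>i. f (e i) *\<^sub>R e i"
  have z: "?z \<bullet> e i = f (e i)" for i by (rule coord_suminf) (rule summable_functional_sq, fact)
  have "f x = x \<bullet> ?z" for x
  proof -
    have "(\<lambda>i. f ((x \<bullet> e i) *\<^sub>R e i)) sums f x" by (rule f.sums) (rule basis_expansion)
    then have "(\<lambda>i. (x \<bullet> e i) * (?z \<bullet> e i)) sums f x" by (simp add: f.scaleR z)
    then show ?thesis using Parseval sums_unique2 by blast
  qed
  then show ?thesis by blast
qed

lemma adjoint_bounded:
  fixes A :: "'x \<Rightarrow> 'y::real_inner"
  assumes "bounded_linear A"
  shows "A x \<bullet> y = x \<bullet> adjoint A y"
proof -
  have "\<exists>z. \<forall>x. A x \<bullet> y = x \<bullet> z" for y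
    by (rule Riesz) (rule bounded_linear_compose[OF bounded_linear_inner_left assms])
  then obtain A' where "\<forall>y x. A x \<bullet> y = x \<bullet> A' y" by metis
  then have "\<forall>x y. A x \<bullet> y = x \<bullet> adjoint A y" using adjoint_unique by metis
  then show ?thesis by blast
qed

text \<open>The operator with eigenvector \<open>e i\<close> for each eigenvalue \<open>m i\<close>. It is used for bounded \<open>m\<close> only;
  the powers of the covariance and the resolvent of \<open>B\<^sup>*B\<close> are of this form.\<close>

definition diag :: "(nat \<Rightarrow> real) \<Rightarrow> 'x \<Rightarrow> 'x" where
  "diag m x = (\<Sum>i. (m i * (x \<bullet> e i)) *\<^sub>R e i)"

lemma summable_diag:
  assumes "\<And>i. \<bar>m i\<bar> \<le> C"
  shows "summable (\<lambda>i. (m i * (x \<bullet> e i))\<^sup>2)"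
proof (rule summable_comparison_test')
  show "summable (\<lambda>i. C\<^sup>2 * (x \<bullet> e i)\<^sup>2)" by (intro summable_mult summable_coord_sq)
  show "norm ((m n * (x \<bullet> e n))\<^sup>2) \<le> C\<^sup>2 * (x \<bullet> e n)\<^sup>2" if "n \<ge> 0" for n
    using power_mono[OF assms[of n], of 2]
    by (simp add: power_mult_distrib mult_right_mono)
qed

lemma coord_diag:
  assumes "\<And>i. \<bar>m i\<bar> \<le> C"
  shows "diag m x \<bullet> e i = m i * (x \<bullet> e i)"
  unfolding diag_def by (rule coord_suminf) (rule summable_diag[OF assms])

lemma norm_diag_sq:
  assumes "\<And>i. \<bar>m i\<bar> \<le> C"
  shows "(\<lambda>i. (m i)\<^sup>2 * (x \<bullet> e i)\<^sup>2) sums (norm (diag m x))\<^sup>2"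
  using Parseval_norm[of "diag m x"] by (simp add: coord_diag[OF assms] power_mult_distrib)

lemma bounded_linear_diag:
  assumes "\<And>i. \<bar>m i\<bar> \<le> C"
  shows "bounded_linear (diag m)"
proof (rule bounded_linear_intro)
  show "diag m (x + y) = diag m x + diag m y" for x y
    by (rule basis_ext) (simp add: coord_diag[OF assms] inner_add_left algebra_simps)
  show "diag m (r *\<^sub>R x) = r *\<^sub>R diag m x" for r x
    by (rule basis_ext) (simp add: coord_diag[OF assms])
  show "norm (diag m x) \<le> norm x * C" for x
  proof -
    have "(norm (diag m x))\<^sup>2 \<le> C\<^sup>2 * (norm x)\<^sup>2"
    proof (rule sums_le[OF _ norm_diag_sq[OF assms] sums_mult[OF Parseval_norm]])
      show "(m i)\<^sup>2 * (x \<bullet> e i)\<^sup>2 \<le> C\<^sup>2 * (x \<bullet> e i)\<^sup>2" for i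
        using power_mono[OF assms[of i], of 2] by (simp add: mult_right_mono)
    qed
    moreover have "C \<ge> 0" using assms[of 0] by linarith
    ultimately show ?thesis
      using power2_le_imp_le[of "norm (diag m x)" "norm x * C"] by (simp add: power_mult_distrib mult.commute)
  qed
qed

lemma diag_self_adjoint:
  assumes "\<And>i. \<bar>m i\<bar> \<le> C"
  shows "diag m x \<bullet> y = x \<bullet> diag m y"
proof -
  have "(\<lambda>i. (m i * (x \<bullet> e i)) * (y \<bullet> e i)) sums (diag m x \<bullet> y)"
    using Parseval[of "diag m x" y] by (simp add: coord_diag[OF assms])
  moreover have "(\<lambda>i. (m i * (x \<bullet> e i)) * (y \<bullet> e i)) sums (x \<bullet> diag m y)"
    using Parseval[of x "diag m y"] by (simp add: coord_diag[OF assms] mult_ac)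
  ultimately show ?thesis by (rule sums_unique2)
qed

end

section \<open>White noise and its Hilbert--Schmidt images\<close>

lemma (in prob_space) normal_second_moment:
  assumes X: "distributed M lborel X (normal_density \<mu> s)" and s: "s > 0"
  shows "(\<integral>\<^sup>+\<omega>. ennreal ((X \<omega>)\<^sup>2) \<partial>M) = ennreal (\<mu>\<^sup>2 + s\<^sup>2)"
proof -
  have 2: "has_bochner_integral lborel (\<lambda>x. normal_density \<mu> s x * (x - \<mu>)\<^sup>2) (s\<^sup>2)"
    using normal_moment_even[OF s, of \<mu> 1] by (simp add: fact_numeral)
  have 1: "has_bochner_integral lborel (\<lambda>x. 2 * \<mu> * (normal_density \<mu> s x * x)) (2 * \<mu> * \<mu>)"
    by (intro has_bochner_integral_mult_right normal_moment_nz_1 s)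
  have 0: "has_bochner_integral lborel (\<lambda>x. \<mu>\<^sup>2 * normal_density \<mu> s x) (\<mu>\<^sup>2 * 1)"
    using s by (intro has_bochner_integral_mult_right) (simp add: has_bochner_integral_iff)
  have "has_bochner_integral lborel (\<lambda>x. normal_density \<mu> s x * x\<^sup>2) (\<mu>\<^sup>2 + s\<^sup>2)"
    using has_bochner_integral_diff[OF has_bochner_integral_add[OF 2 1] 0]
    by (rule has_bochner_integral_cong[THEN iffD1, rotated -1]) (auto simp: power2_eq_square algebra_simps)
  then have "(\<integral>\<^sup>+x. ennreal (normal_density \<mu> s x * x\<^sup>2) \<partial>lborel) = ennreal (\<mu>\<^sup>2 + s\<^sup>2)"
    by (subst nn_integral_eq_integral) (auto simp: has_bochner_integral_iff normal_density_nonneg)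
  then show ?thesis
    using distributed_nn_integral[OF X, of "\<lambda>x. ennreal (x\<^sup>2)"]
    by (simp add: ennreal_mult' normal_density_nonneg)
qed

lemma white_noise_zero:
  assumes "white_noise M \<gamma> Z"
  shows "AE \<omega> in M. Z 0 \<omega> = 0"
proof -
  have "AE \<omega> in M. Z (1 *\<^sub>R 0 + 0) \<omega> = 1 * Z 0 \<omega> + Z 0 \<omega>"
    using assms unfolding white_noise_def by blast
  then show ?thesis by simp
qed

lemma white_noise_linear:
  "white_noise M \<gamma> Z \<Longrightarrow> AE \<omega> in M. Z (c *\<^sub>R y + z) \<omega> = c * Z y \<omega> + Z z \<omega>"
  unfolding white_noise_def by blast

lemma white_noise_measurable: "white_noise M \<gamma> Z \<Longrightarrow> Z y \<in> borel_measurable M"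
  unfolding white_noise_def by blast

lemma white_noise_sum:
  assumes "white_noise M \<gamma> Z"
  shows "AE \<omega> in M. Z (\<Sum>i<(n::nat). c i *\<^sub>R y i) \<omega> = (\<Sum>i<n. c i * Z (y i) \<omega>)"
proof (induction n)
  case 0
  show ?case using white_noise_zero[OF assms] by simp
next
  case (Suc n)
  with white_noise_linear[OF assms, of "c n" "y n" "\<Sum>i<n. c i *\<^sub>R y i"]
  show ?case by eventually_elim (simp add: add.commute)
qed

lemma white_noise_second_moment:
  assumes "prob_space M" "\<gamma> > 0" and Z: "white_noise M \<gamma> Z"
  shows "(\<integral>\<^sup>+\<omega>. ennreal ((Z y \<omega>)\<^sup>2) \<partial>M) = ennreal (\<gamma>\<^sup>2 * (norm y)\<^sup>2)"
proof (cases "y = 0")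
  case True
  have "(\<integral>\<^sup>+\<omega>. ennreal ((Z y \<omega>)\<^sup>2) \<partial>M) = (\<integral>\<^sup>+\<omega>. 0 \<partial>M)"
    using white_noise_zero[OF Z] True by (intro nn_integral_cong_AE) auto
  with True show ?thesis by simp
next
  case False
  then have "distributed M lborel (Z y) (normal_density 0 (\<gamma> * norm y))"
    using Z unfolding white_noise_def by blast
  from prob_space.normal_second_moment[OF assms(1) this] False assms(2)
  show ?thesis by (simp add: power_mult_distrib)
qed

context hilbert_basis begin

text \<open>For Hilbert--Schmidt \<open>T'\<close> the squares of the coefficients \<open>Z (T' (e i))\<close> have a finite total
  expectation, so the series converges almost surely and its inner product with \<open>x\<close> is the limit of
  the partial sums \<open>Z (T' p\<^sub>n)\<close>, where \<open>p\<^sub>n\<close> is the truncated expansion of \<open>x\<close>. The same partial sums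
  converge to \<open>Z (T' x)\<close> in mean square, because the second moment of \<open>Z (T' (x - p\<^sub>n))\<close> is a multiple
  of \<open>(norm (T' (x - p\<^sub>n)))\<^sup>2\<close>. By Fatou's lemma the two limits agree almost surely.\<close>

lemma white_noise_series:
  fixes Z :: "'y::real_inner \<Rightarrow> 'w \<Rightarrow> real" and T' :: "'x \<Rightarrow> 'y"
  assumes M: "prob_space M" and \<gamma>: "\<gamma> > 0" and Z: "white_noise M \<gamma> Z"
    and T': "bounded_linear T'" and HS: "summable (\<lambda>i. (norm (T' (e i)))\<^sup>2)"
  shows "AE \<omega> in M. (\<Sum>i. Z (T' (e i)) \<omega> *\<^sub>R e i) \<bullet> x = Z (T' x) \<omega>"
proof -
  note [measurable] = white_noise_measurable[OF Z]
  interpret T': bounded_linear T' by fact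
  let ?\<zeta> = "\<lambda>\<omega>. \<Sum>i. Z (T' (e i)) \<omega> *\<^sub>R e i"
  let ?s = "\<lambda>n \<omega>. \<Sum>i<n. (x \<bullet> e i) * Z (T' (e i)) \<omega>"
  let ?p = "\<lambda>n. \<Sum>i<n. (x \<bullet> e i) *\<^sub>R e i"
  have "(\<integral>\<^sup>+\<omega>. (\<Sum>i. ennreal ((Z (T' (e i)) \<omega>)\<^sup>2)) \<partial>M) = (\<Sum>i. ennreal (\<gamma>\<^sup>2 * (norm (T' (e i)))\<^sup>2))"
    by (simp add: nn_integral_suminf white_noise_second_moment[OF M \<gamma> Z])
  also have "\<dots> = ennreal (\<Sum>i. \<gamma>\<^sup>2 * (norm (T' (e i)))\<^sup>2)"
    by (rule suminf_ennreal2) (auto intro: summable_mult HS)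
  finally have "AE \<omega> in M. (\<Sum>i. ennreal ((Z (T' (e i)) \<omega>)\<^sup>2)) \<noteq> \<infinity>"
    by (intro nn_integral_PInf_AE) auto
  then have lim: "AE \<omega> in M. (\<lambda>n. ?s n \<omega>) \<longlonglongrightarrow> ?\<zeta> \<omega> \<bullet> x"
  proof eventually_elim
    case (elim \<omega>)
    then have "summable (\<lambda>i. (Z (T' (e i)) \<omega>)\<^sup>2)"
      by (intro summable_suminf_not_top) auto
    from Parseval[of "?\<zeta> \<omega>" x] coord_suminf[OF this] show ?case
      by (simp add: sums_def mult.commute)
  qed
  have lin: "AE \<omega> in M. \<forall>n. Z (T' (x - ?p n)) \<omega> = Z (T' x) \<omega> - ?s n \<omega>"
    unfolding AE_all_countable
  proof
    fix n
    have "AE \<omega> in M. Z (1 *\<^sub>R T' (x - ?p n) + T' (?p n)) \<omega> = 1 * Z (T' (x - ?p n)) \<omega> + Z (T' (?p n)) \<omega>"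
      by (rule white_noise_linear[OF Z])
    moreover have "AE \<omega> in M. Z (T' (?p n)) \<omega> = ?s n \<omega>"
      using white_noise_sum[OF Z, where c="\<lambda>i. x \<bullet> e i" and y="\<lambda>i. T' (e i)"]
      by (simp add: T'.sum T'.scaleR)
    ultimately show "AE \<omega> in M. Z (T' (x - ?p n)) \<omega> = Z (T' x) \<omega> - ?s n \<omega>"
      by eventually_elim (simp add: T'.diff)
  qed
  have "(\<integral>\<^sup>+\<omega>. liminf (\<lambda>n. ennreal ((Z (T' (x - ?p n)) \<omega>)\<^sup>2)) \<partial>M)
      \<le> liminf (\<lambda>n. \<integral>\<^sup>+\<omega>. ennreal ((Z (T' (x - ?p n)) \<omega>)\<^sup>2) \<partial>M)"
    by (rule nn_integral_liminf) simp
  also have "\<dots> = liminf (\<lambda>n. ennreal (\<gamma>\<^sup>2 * (norm (T' (x - ?p n)))\<^sup>2))"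
    by (simp add: white_noise_second_moment[OF M \<gamma> Z])
  also have "\<dots> = 0"
  proof -
    have "(\<lambda>n. x - ?p n) \<longlonglongrightarrow> x - x"
      by (intro tendsto_intros) (use basis_expansion[of x] in \<open>simp add: sums_def\<close>)
    from T'.tendsto[OF this]
    have "(\<lambda>n. \<gamma>\<^sup>2 * (norm (T' (x - ?p n)))\<^sup>2) \<longlonglongrightarrow> \<gamma>\<^sup>2 * (norm (T' (x - x)))\<^sup>2"
      by (intro tendsto_intros)
    then have "(\<lambda>n. ennreal (\<gamma>\<^sup>2 * (norm (T' (x - ?p n)))\<^sup>2)) \<longlonglongrightarrow> ennreal 0"
      by (intro tendsto_ennrealI) (simp add: T'.zero)
    then show ?thesis by (intro lim_imp_Liminf) auto
  qed
  finally have "(\<integral>\<^sup>+\<omega>. liminf (\<lambda>n. ennreal ((Z (T' (x - ?p n)) \<omega>)\<^sup>2)) \<partial>M) = 0" by simp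
  then have "AE \<omega> in M. liminf (\<lambda>n. ennreal ((Z (T' (x - ?p n)) \<omega>)\<^sup>2)) = 0"
    by (subst (asm) nn_integral_0_iff_AE) auto
  with lim lin show ?thesis
  proof eventually_elim
    case (elim \<omega>)
    have "(\<lambda>n. ennreal ((Z (T' x) \<omega> - ?s n \<omega>)\<^sup>2)) \<longlonglongrightarrow> ennreal ((Z (T' x) \<omega> - ?\<zeta> \<omega> \<bullet> x)\<^sup>2)"
      by (intro tendsto_ennrealI tendsto_intros elim(1))
    from lim_imp_Liminf[OF _ this] elim(2,3)
    have "ennreal ((Z (T' x) \<omega> - ?\<zeta> \<omega> \<bullet> x)\<^sup>2) = 0" by simp
    then show ?case by simp
  qed
qed

text \<open>The series of the previous lemma, shifted by \<open>T m\<close>, witnesses that the choice in the definition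
  of \<open>cylindrical_image\<close> is not vacuous.\<close>

lemma coord_cylindrical_image:
  fixes Z :: "'y::real_inner \<Rightarrow> 'w \<Rightarrow> real" and T' :: "'x \<Rightarrow> 'y"
  assumes M: "prob_space M" and \<gamma>: "\<gamma> > 0" and Z: "white_noise M \<gamma> Z"
    and adj: "\<And>y x. T y \<bullet> x = y \<bullet> T' x"
    and T': "bounded_linear T'" and HS: "summable (\<lambda>i. (norm (T' (e i)))\<^sup>2)"
  shows "AE \<omega> in M. cylindrical_image M T (\<lambda>v \<omega>. m \<bullet> v + Z v \<omega>) \<omega> \<bullet> x = m \<bullet> T' x + Z (T' x) \<omega>"
proof -
  note [measurable] = white_noise_measurable[OF Z]
  have eq: "adjoint T = T'" using adj adjoint_unique by blast
  let ?\<xi> = "\<lambda>\<omega>. T m + (\<Sum>i. Z (T' (e i)) \<omega> *\<^sub>R e i)"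
  have "?\<xi> \<in> borel_measurable M" by measurable
  moreover have "AE \<omega> in M. ?\<xi> \<omega> \<bullet> x = m \<bullet> T' x + Z (T' x) \<omega>" for x
    using white_noise_series[OF M \<gamma> Z T' HS, of x]
    by eventually_elim (simp add: inner_add_left adj)
  ultimately have "\<exists>\<xi>. \<xi> \<in> borel_measurable M \<and>
      (\<forall>x. AE \<omega> in M. \<xi> \<omega> \<bullet> x = m \<bullet> adjoint T x + Z (adjoint T x) \<omega>)"
    unfolding eq by blast
  from someI_ex[OF this] show ?thesis
    unfolding cylindrical_image_def eq by blast
qed

end

section \<open>Bias and variance of averaged 3DVAR in coordinates\<close>

text \<open>A weighted sum of independent centred Gaussians is Gaussian with the sum of the variances, and the
  shift \<open>b\<close> becomes its mean.\<close>

lemma iid_weighted_sum_second_moment: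
  fixes \<eta> :: "nat \<Rightarrow> 'y::real_inner \<Rightarrow> 'w \<Rightarrow> real"
  assumes iid: "iid_white_noise M \<gamma> \<eta>" and \<gamma>: "\<gamma> > 0" and h: "h \<noteq> 0" and n: "n \<ge> 1"
    and w: "\<And>j. j \<in> {1..n} \<Longrightarrow> w j > 0"
  shows "(\<integral>\<^sup>+\<omega>. ennreal ((b + (\<Sum>j=1..n. w j * \<eta> j h \<omega>))\<^sup>2) \<partial>M)
    = ennreal (b\<^sup>2 + \<gamma>\<^sup>2 * (norm h)\<^sup>2 * (\<Sum>j=1..n. (w j)\<^sup>2))"
proof -
  interpret prob_space M using iid unfolding iid_white_noise_def by blast
  have ind: "indep_vars (\<lambda>_. PiM UNIV (\<lambda>_. borel)) (\<lambda>k \<omega> y. \<eta> k y \<omega>) {1..}"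
    and wn: "\<And>k. k \<ge> 1 \<Longrightarrow> white_noise M \<gamma> (\<eta> k)"
    using iid unfolding iid_white_noise_def by blast+
  let ?s = "\<lambda>j. w j * (\<gamma> * norm h)"
  have s: "?s j > 0" if "j \<in> {1..n}" for j using w[OF that] \<gamma> h by simp
  have "indep_vars (\<lambda>_. PiM UNIV (\<lambda>_. borel)) (\<lambda>k \<omega> y. \<eta> k y \<omega>) {1..n}"
    by (rule indep_vars_subset[OF ind]) auto
  then have "indep_vars (\<lambda>_. borel) (\<lambda>j \<omega>. (\<lambda>f. w j * f h) (\<lambda>y. \<eta> j y \<omega>)) {1..n}"
    by (rule indep_vars_compose2) measurable
  then have ind': "indep_vars (\<lambda>_. borel) (\<lambda>j \<omega>. w j * \<eta> j h \<omega>) {1..n}" by simp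
  have "distributed M lborel (\<lambda>\<omega>. w j * \<eta> j h \<omega>) (normal_density 0 (?s j))" if "j \<in> {1..n}" for j
  proof -
    have "distributed M lborel (\<eta> j h) (normal_density 0 (\<gamma> * norm h))"
      using wn[of j] that h unfolding white_noise_def by auto
    from normal_density_affine[OF this, of "w j" 0] w[OF that] \<gamma> h show ?thesis by simp
  qed
  from sum_indep_normal[OF _ _ ind' s this] n
  have S: "distributed M lborel (\<lambda>\<omega>. \<Sum>j=1..n. w j * \<eta> j h \<omega>) (normal_density 0 (sqrt (\<Sum>j=1..n. (?s j)\<^sup>2)))"
    by simp
  have "(\<Sum>j=1..n. (?s j)\<^sup>2) > 0"
  proof (rule sum_pos)
    show "(?s j)\<^sup>2 > 0" if "j \<in> {1..n}" for j by (rule zero_less_power[OF s[OF that]])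
  qed (use n in auto)
  then have pos: "sqrt (\<Sum>j=1..n. (?s j)\<^sup>2) > 0" by simp
  from normal_density_affine[OF S pos, of 1 b]
  have "distributed M lborel (\<lambda>\<omega>. b + (\<Sum>j=1..n. w j * \<eta> j h \<omega>)) (normal_density b (sqrt (\<Sum>j=1..n. (?s j)\<^sup>2)))"
    by simp
  from normal_second_moment[OF this pos]
  have "(\<integral>\<^sup>+\<omega>. ennreal ((b + (\<Sum>j=1..n. w j * \<eta> j h \<omega>))\<^sup>2) \<partial>M) = ennreal (b\<^sup>2 + (\<Sum>j=1..n. (?s j)\<^sup>2))"
    by (simp add: sum_nonneg)
  also have "(\<Sum>j=1..n. (?s j)\<^sup>2) = \<gamma>\<^sup>2 * (norm h)\<^sup>2 * (\<Sum>j=1..n. (w j)\<^sup>2)"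
    by (simp add: power_mult_distrib sum_distrib_left mult_ac)
  finally show ?thesis .
qed

text \<open>A forward operator whose normal operator is diagonal in the basis with eigenvalues \<open>c i\<close>, and a
  trace-class covariance with eigenvalues \<open>s i\<close>. Everything about 3DVAR then decouples into scalar
  recursions, one for each basis vector.\<close>

locale diagonal_inverse_problem = hilbert_basis e
  for e :: "nat \<Rightarrow> 'x::{real_inner,banach,second_countable_topology}" +
  fixes A :: "'x \<Rightarrow> 'y::real_inner" and s c :: "nat \<Rightarrow> real" and \<alpha> :: real
  assumes bounded_A: "bounded_linear A"
    and AA: "adjoint A (A (e i)) = c i *\<^sub>R e i"
    and s_pos: "s i > 0" and c_pos: "c i > 0"
    and summable_s: "summable s"
    and bounded_c: "\<exists>C. \<forall>i. c i \<le> C"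
    and \<alpha>_pos: "\<alpha> > 0"
begin

abbreviation "R \<equiv> diag (\<lambda>i. s i powr (1/2))"
abbreviation "K \<equiv> gain A R \<alpha>"
text \<open>\<open>lam\<close> lists the eigenvalues of \<open>B\<^sup>*B\<close> for \<open>B = A R\<close>, \<open>r\<close> those of the one-step error propagator
  \<open>I - K A\<close>, and \<open>Kadj\<close> is the adjoint of the gain.\<close>

definition lam where "lam i = s i * c i"
definition r where "r i = \<alpha> / (\<alpha> + lam i)"
definition resolvent where "resolvent = diag (\<lambda>i. 1 / (\<alpha> + lam i))"
definition Kadj where "Kadj x = A (R (resolvent (R x)))"

lemma lam_pos: "lam i > 0"
  using s_pos c_pos by (simp add: lam_def)

lemma r_bounds: "0 < r i" "r i < 1"
  using \<alpha>_pos lam_pos[of i] by (auto simp: r_def)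

lemma one_minus_r: "1 - r i = lam i / (\<alpha> + lam i)"
  using \<alpha>_pos lam_pos[of i] by (simp add: r_def field_simps)

lemma bounded_s_powr:
  assumes "p \<ge> 0"
  obtains C where "\<And>i. \<bar>s i powr p\<bar> \<le> C"
proof -
  have "Bseq s" by (rule convergent_imp_Bseq) (use summable_LIMSEQ_zero[OF summable_s] in \<open>auto simp: convergent_def\<close>)
  then obtain C where C: "\<And>i. norm (s i) \<le> C" by (auto simp: Bseq_def)
  have "\<bar>s i powr p\<bar> \<le> C powr p" for i
    using C[of i] s_pos[of i] assms by (simp add: powr_mono2)
  then show thesis by (rule that)
qed

lemma coord_diag_powr: "p \<ge> 0 \<Longrightarrow> diag (\<lambda>i. s i powr p) x \<bullet> e i = s i powr p * (x \<bullet> e i)"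
  using bounded_s_powr coord_diag by metis

lemma bounded_R: "bounded_linear R"
proof -
  obtain C where "\<And>i. \<bar>s i powr (1/2)\<bar> \<le> C" using bounded_s_powr[of "1/2"] by auto
  then show ?thesis by (rule bounded_linear_diag)
qed

lemma R_self_adjoint: "R x \<bullet> y = x \<bullet> R y"
proof -
  obtain C where "\<And>i. \<bar>s i powr (1/2)\<bar> \<le> C" using bounded_s_powr[of "1/2"] by auto
  then show ?thesis by (rule diag_self_adjoint)
qed

lemma half_powr_sq: "s i powr (1/2) * s i powr (1/2) = s i"
  using s_pos[of i] by (simp flip: powr_add)

lemma resolvent_bound: "\<bar>1 / (\<alpha> + lam i)\<bar> \<le> 1 / \<alpha>"
  using \<alpha>_pos lam_pos[of i] by (simp add: frac_le)

lemma coord_resolvent: "resolvent x \<bullet> e i = (x \<bullet> e i) / (\<alpha> + lam i)"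
  unfolding resolvent_def by (simp add: coord_diag[OF resolvent_bound])

lemma adjoint_B: "adjoint (A \<circ> R) = R \<circ> adjoint A"
  by (rule adjoint_unique) (simp add: adjoint_bounded[OF bounded_A] R_self_adjoint)

lemma coord_normal_operator: "adjoint A (A x) \<bullet> e i = c i * (x \<bullet> e i)"
proof -
  have "adjoint A (A x) \<bullet> e i = A x \<bullet> A (e i)"
    using adjoint_bounded[OF bounded_A, of "e i" "A x"] by (simp add: inner_commute)
  also have "\<dots> = x \<bullet> adjoint A (A (e i))" by (rule adjoint_bounded[OF bounded_A])
  finally show ?thesis by (simp add: AA)
qed

lemma coord_regularized:
  "(\<alpha> *\<^sub>R x + adjoint (A \<circ> R) ((A \<circ> R) x)) \<bullet> e i = (\<alpha> + lam i) * (x \<bullet> e i)"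
  using half_powr_sq[of i]
  by (simp add: adjoint_B inner_add_left coord_diag_powr coord_normal_operator lam_def algebra_simps)

text \<open>The inverse taken in the definition of the gain is that of a diagonal operator whose eigenvalues are
  bounded below by \<open>\<alpha> > 0\<close>.\<close>

lemma inv_regularized: "inv (\<lambda>x. \<alpha> *\<^sub>R x + adjoint (A \<circ> R) ((A \<circ> R) x)) = resolvent"
proof (rule inv_unique_comp; rule ext; rule basis_ext)
  have nz: "\<alpha> + lam i \<noteq> 0" for i using \<alpha>_pos lam_pos[of i] by simp
  fix x i
  show "((\<lambda>x. \<alpha> *\<^sub>R x + adjoint (A \<circ> R) ((A \<circ> R) x)) \<circ> resolvent) x \<bullet> e i = id x \<bullet> e i"
    using nz[of i] unfolding o_apply[of _ resolvent] coord_regularized by (simp add: coord_resolvent)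
  show "(resolvent \<circ> (\<lambda>x. \<alpha> *\<^sub>R x + adjoint (A \<circ> R) ((A \<circ> R) x))) x \<bullet> e i = id x \<bullet> e i"
    using nz[of i] unfolding o_apply[of resolvent] coord_resolvent coord_regularized by simp
qed

lemma gain_eq: "K y = R (resolvent (R (adjoint A y)))"
  unfolding gain_def Let_def unfolding inv_regularized unfolding adjoint_B by simp

lemma gain_adjoint: "K y \<bullet> x = y \<bullet> Kadj x"
proof -
  have "K y \<bullet> x = adjoint A y \<bullet> R (resolvent (R x))"
    unfolding gain_eq resolvent_def
    by (simp add: R_self_adjoint diag_self_adjoint[OF resolvent_bound])
  also have "\<dots> = y \<bullet> Kadj x"
    unfolding Kadj_def using adjoint_bounded[OF bounded_A, of "R (resolvent (R x))" y]
    by (metis inner_commute)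
  finally show ?thesis .
qed

lemma bounded_Kadj: "bounded_linear Kadj"
proof -
  have "bounded_linear resolvent"
    unfolding resolvent_def by (rule bounded_linear_diag[OF resolvent_bound])
  then show ?thesis
    unfolding Kadj_def
    by (intro bounded_linear_compose[OF bounded_A] bounded_linear_compose[OF bounded_R]) (rule bounded_linear_compose, auto intro: bounded_R)
qed

lemma Kadj_basis: "Kadj (e i) = (s i / (\<alpha> + lam i)) *\<^sub>R A (e i)"
proof -
  have "R (resolvent (R (e i))) = (s i / (\<alpha> + lam i)) *\<^sub>R e i"
  proof (rule basis_ext)
    fix j show "R (resolvent (R (e i))) \<bullet> e j = ((s i / (\<alpha> + lam i)) *\<^sub>R e i) \<bullet> e j"
      unfolding resolvent_def using half_powr_sq[of j]
      by (simp add: coord_diag_powr coord_diag[OF resolvent_bound] inner_basis)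
  qed
  then show ?thesis
    by (simp add: Kadj_def linear_simps(5)[OF bounded_A])
qed

lemma norm_A_basis: "(norm (A (e i)))\<^sup>2 = c i"
  unfolding power2_norm_eq_inner by (simp add: adjoint_bounded[OF bounded_A] AA inner_basis)

lemma norm_Kadj_basis: "(norm (Kadj (e i)))\<^sup>2 = (s i / (\<alpha> + lam i))\<^sup>2 * c i"
  by (simp add: Kadj_basis power_mult_distrib norm_A_basis power_divide)

text \<open>In this form the factor \<open>(1 - r i)\<^sup>2\<close> cancels the denominator of the geometric sums that the
  averaged noise produces, see \<open>sum_weight_sq_le\<close> below.\<close>

lemma norm_Kadj_basis': "(norm (Kadj (e i)))\<^sup>2 = (1 - r i)\<^sup>2 / c i"
proof -
  have "(s i / x)\<^sup>2 * c i = (s i * c i / x)\<^sup>2 / c i" for x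
    using c_pos[of i] by (simp add: power_divide power2_eq_square)
  from this[of "\<alpha> + lam i"] show ?thesis by (simp add: norm_Kadj_basis one_minus_r lam_def)
qed

lemma Kadj_basis_nonzero: "Kadj (e i) \<noteq> 0"
  using norm_Kadj_basis'[of i] c_pos[of i] r_bounds[of i] by auto

lemma summable_Kadj: "summable (\<lambda>i. (norm (Kadj (e i)))\<^sup>2)"
proof -
  obtain S where S: "\<And>i. \<bar>s i powr 1\<bar> \<le> S" using bounded_s_powr[of 1] by auto
  obtain C where C: "\<And>i. c i \<le> C" using bounded_c by blast
  show ?thesis
  proof (rule summable_comparison_test')
    show "summable (\<lambda>i. S * C / \<alpha>\<^sup>2 * s i)" by (intro summable_mult summable_s)
    fix i
    have "s i * c i \<le> S * C" 
      using S[of i] C[of i] s_pos[of i] c_pos[of i] by (intro mult_mono) auto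
    moreover have "(s i / (\<alpha> + lam i))\<^sup>2 \<le> (s i / \<alpha>)\<^sup>2"
      using s_pos[of i] \<alpha>_pos lam_pos[of i] by (intro power_mono divide_left_mono) auto
    ultimately have "(norm (Kadj (e i)))\<^sup>2 \<le> (s i / \<alpha>)\<^sup>2 * c i"
      and "(s i * c i) * (s i / \<alpha>\<^sup>2) \<le> (S * C) * (s i / \<alpha>\<^sup>2)"
      unfolding norm_Kadj_basis using c_pos[of i] s_pos[of i]
      by (intro mult_right_mono; simp)+
    then show "norm ((norm (Kadj (e i)))\<^sup>2) \<le> S * C / \<alpha>\<^sup>2 * s i"
      by (simp add: power_divide power2_eq_square mult_ac)
  qed
qed

lemma coord_KA: "K (A x) \<bullet> e i = (1 - r i) * (x \<bullet> e i)"
proof -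
  have "K (A x) \<bullet> e i = s i / (\<alpha> + lam i) * (A x \<bullet> A (e i))"
    by (simp add: gain_adjoint Kadj_basis)
  also have "A x \<bullet> A (e i) = c i * (x \<bullet> e i)"
    using coord_normal_operator[of x i] adjoint_bounded[OF bounded_A, of "e i" "A x"]
    by (simp add: inner_commute)
  finally show ?thesis by (simp add: one_minus_r lam_def)
qed

text \<open>In the direction \<open>e i\<close> the error solves the scalar recursion \<open>x\<^sub>n = r x\<^sub>n\<^sub>-\<^sub>1 + \<xi>\<^sub>n\<close> with noise
  \<open>\<xi>\<^sub>n = \<eta>\<^sub>n (Kadj (e i))\<close>.\<close>

lemma coord_threedvar:
  fixes \<eta> :: "nat \<Rightarrow> 'y \<Rightarrow> 'w \<Rightarrow> real" and u0 ud :: 'x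
  assumes iid: "iid_white_noise M \<gamma> \<eta>" and \<gamma>: "\<gamma> > 0"
  defines "u \<equiv> threedvar M A K (data A ud \<eta>) u0"
  shows "AE \<omega> in M. (u n \<omega> - ud) \<bullet> e i =
    r i ^ n * ((u0 - ud) \<bullet> e i) + (\<Sum>j=1..n. r i ^ (n - j) * \<eta> j (Kadj (e i)) \<omega>)"
proof (induction n)
  case 0
  show ?case by (simp add: u_def)
next
  case (Suc n)
  have "prob_space M" and wn: "white_noise M \<gamma> (\<eta> (Suc n))"
    using iid unfolding iid_white_noise_def by auto
  have "data A ud \<eta> (Suc n) = (\<lambda>v \<omega>. A ud \<bullet> v + \<eta> (Suc n) v \<omega>)"
    by (intro ext) (simp add: data_def)
  then have "AE \<omega> in M. cylindrical_image M K (data A ud \<eta> (Suc n)) \<omega> \<bullet> e i =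
      A ud \<bullet> Kadj (e i) + \<eta> (Suc n) (Kadj (e i)) \<omega>"
    using coord_cylindrical_image[OF \<open>prob_space M\<close> \<gamma> wn gain_adjoint bounded_Kadj summable_Kadj]
    by simp
  with Suc.IH show ?case
  proof eventually_elim
    case (elim \<omega>)
    have "(u (Suc n) \<omega> - ud) \<bullet> e i = r i * ((u n \<omega> - ud) \<bullet> e i) + \<eta> (Suc n) (Kadj (e i)) \<omega>"
      using elim(2) gain_adjoint[of "A ud" "e i", symmetric]
      by (simp add: u_def inner_add_left inner_diff_left coord_KA algebra_simps)
    also have "\<dots> = r i ^ Suc n * ((u0 - ud) \<bullet> e i) +
        (\<Sum>j=1..Suc n. r i ^ (Suc n - j) * \<eta> j (Kadj (e i)) \<omega>)"
    proof -
      have "r i * (\<Sum>j=1..n. r i ^ (n - j) * \<eta> j (Kadj (e i)) \<omega>)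
          = (\<Sum>j=1..n. r i ^ (Suc n - j) * \<eta> j (Kadj (e i)) \<omega>)"
        unfolding sum_distrib_left by (intro sum.cong) (auto simp: Suc_diff_le)
      then show ?thesis by (simp add: elim(1) distrib_left)
    qed
    finally show ?case .
  qed
qed

text \<open>After averaging, the initial error is multiplied by \<open>decay\<close> and the \<open>j\<close>-th noise by \<open>weight\<close>.\<close>

definition weight where "weight i n j = (\<Sum>k=j..n. r i ^ (k - j)) / real n"
definition decay where "decay i n = (\<Sum>k=1..n. r i ^ k) / real n"

lemma coord_average:
  fixes \<eta> :: "nat \<Rightarrow> 'y \<Rightarrow> 'w \<Rightarrow> real" and u0 ud :: 'x
  assumes iid: "iid_white_noise M \<gamma> \<eta>" and \<gamma>: "\<gamma> > 0" and n: "n \<ge> 1"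
  defines "u \<equiv> threedvar M A K (data A ud \<eta>) u0"
  shows "AE \<omega> in M. (iterate_average u n \<omega> - ud) \<bullet> e i =
    decay i n * ((u0 - ud) \<bullet> e i) + (\<Sum>j=1..n. weight i n j * \<eta> j (Kadj (e i)) \<omega>)"
proof -
  have "AE \<omega> in M. \<forall>k. (u k \<omega> - ud) \<bullet> e i =
    r i ^ k * ((u0 - ud) \<bullet> e i) + (\<Sum>j=1..k. r i ^ (k - j) * \<eta> j (Kadj (e i)) \<omega>)"
    unfolding AE_all_countable u_def using coord_threedvar[OF iid \<gamma>] by blast
  then show ?thesis
  proof eventually_elim
    case (elim \<omega>)
    have "iterate_average u n \<omega> - ud = (1 / real n) *\<^sub>R (\<Sum>k=1..n. u k \<omega> - ud)"
      using n by (simp add: iterate_average_def sum_subtractf scaleR_diff_right scaleR_left_diff_distrib sum_constant_scaleR)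
    then have "(iterate_average u n \<omega> - ud) \<bullet> e i = (1 / real n) * (\<Sum>k=1..n. (u k \<omega> - ud) \<bullet> e i)"
      by (simp add: inner_sum_left)
    also have "\<dots> = (1 / real n) * ((\<Sum>k=1..n. r i ^ k) * ((u0 - ud) \<bullet> e i)
        + (\<Sum>k=1..n. \<Sum>j=1..k. r i ^ (k - j) * \<eta> j (Kadj (e i)) \<omega>))"
      by (simp add: elim sum.distrib sum_distrib_right)
    also have "(\<Sum>k=1..n. \<Sum>j=1..k. r i ^ (k - j) * \<eta> j (Kadj (e i)) \<omega>)
        = (\<Sum>k=1..n. \<Sum>j\<in>{j\<in>{1..n}. j \<le> k}. r i ^ (k - j) * \<eta> j (Kadj (e i)) \<omega>)"
      by (intro sum.cong) auto
    also have "\<dots> = (\<Sum>j=1..n. \<Sum>k\<in>{k\<in>{1..n}. j \<le> k}. r i ^ (k - j) * \<eta> j (Kadj (e i)) \<omega>)"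
      by (rule sum.swap_restrict) auto
    also have "\<dots> = (\<Sum>j=1..n. (\<Sum>k=j..n. r i ^ (k - j)) * \<eta> j (Kadj (e i)) \<omega>)"
      unfolding sum_distrib_right by (intro sum.cong) auto
    also have "\<dots> = real n * (\<Sum>j=1..n. weight i n j * \<eta> j (Kadj (e i)) \<omega>)"
      using n by (simp add: weight_def sum_distrib_left)
    finally show ?case
      using n by (simp add: decay_def distrib_left)
  qed
qed

text \<open>The exact bias--variance decomposition. Independence is used over time only, within each single
  coordinate; Parseval's identity and monotone convergence sum the coordinates.\<close>

lemma nn_integral_error:
  fixes \<eta> :: "nat \<Rightarrow> 'y \<Rightarrow> 'w \<Rightarrow> real" and u0 ud :: 'x
  assumes iid: "iid_white_noise M \<gamma> \<eta>" and \<gamma>: "\<gamma> > 0" and n: "n \<ge> 1" and t: "t \<ge> 0"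
  defines "u \<equiv> threedvar M A K (data A ud \<eta>) u0"
  shows "(\<integral>\<^sup>+\<omega>. ennreal ((norm (diag (\<lambda>i. s i powr (t/2)) (iterate_average u n \<omega> - ud)))\<^sup>2) \<partial>M)
   = (\<Sum>i. ennreal (s i powr t * ((decay i n * ((u0 - ud) \<bullet> e i))\<^sup>2
        + \<gamma>\<^sup>2 * ((1 - r i)\<^sup>2 / c i) * (\<Sum>j=1..n. (weight i n j)\<^sup>2))))"
proof -
  let ?X = "\<lambda>i \<omega>. decay i n * ((u0 - ud) \<bullet> e i) + (\<Sum>j=1..n. weight i n j * \<eta> j (Kadj (e i)) \<omega>)"
  have [measurable]: "\<eta> j y \<in> borel_measurable M" if "j \<in> {1..n}" for j y
    using iid that unfolding iid_white_noise_def white_noise_def by auto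
  obtain C where C: "\<And>i. \<bar>s i powr (t/2)\<bar> \<le> C" using bounded_s_powr[of "t/2"] t by auto
  have "AE \<omega> in M. \<forall>i. (iterate_average u n \<omega> - ud) \<bullet> e i = ?X i \<omega>"
    unfolding AE_all_countable u_def using coord_average[OF iid \<gamma> n] by blast
  then have "AE \<omega> in M. ennreal ((norm (diag (\<lambda>i. s i powr (t/2)) (iterate_average u n \<omega> - ud)))\<^sup>2)
      = (\<Sum>i. ennreal (s i powr t) * ennreal ((?X i \<omega>)\<^sup>2))"
  proof eventually_elim
    case (elim \<omega>)
    have "(\<lambda>i. s i powr t * (?X i \<omega>)\<^sup>2) sums (norm (diag (\<lambda>i. s i powr (t/2)) (iterate_average u n \<omega> - ud)))\<^sup>2"
      using norm_diag_sq[OF C, where x="iterate_average u n \<omega> - ud"]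
      by (simp add: elim power2_eq_square flip: powr_add)
    from suminf_ennreal_eq[OF _ this] show ?case by (simp add: ennreal_mult)
  qed
  then have "(\<integral>\<^sup>+\<omega>. ennreal ((norm (diag (\<lambda>i. s i powr (t/2)) (iterate_average u n \<omega> - ud)))\<^sup>2) \<partial>M)
      = (\<integral>\<^sup>+\<omega>. (\<Sum>i. ennreal (s i powr t) * ennreal ((?X i \<omega>)\<^sup>2)) \<partial>M)"
    by (rule nn_integral_cong_AE)
  also have "\<dots> = (\<Sum>i. ennreal (s i powr t) * (\<integral>\<^sup>+\<omega>. ennreal ((?X i \<omega>)\<^sup>2) \<partial>M))"
    by (subst nn_integral_suminf) (auto simp: nn_integral_cmult)
  also have "\<dots> = (\<Sum>i. ennreal (s i powr t * ((decay i n * ((u0 - ud) \<bullet> e i))\<^sup>2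
        + \<gamma>\<^sup>2 * ((1 - r i)\<^sup>2 / c i) * (\<Sum>j=1..n. (weight i n j)\<^sup>2))))"
  proof (rule suminf_cong)
    fix i
    have "weight i n j > 0" if "j \<in> {1..n}" for j
      unfolding weight_def using that r_bounds[of i] by (intro divide_pos_pos sum_pos) auto
    from iid_weighted_sum_second_moment[OF iid \<gamma> Kadj_basis_nonzero n this]
    show "ennreal (s i powr t) * (\<integral>\<^sup>+\<omega>. ennreal ((?X i \<omega>)\<^sup>2) \<partial>M) =
      ennreal (s i powr t * ((decay i n * ((u0 - ud) \<bullet> e i))\<^sup>2
        + \<gamma>\<^sup>2 * ((1 - r i)\<^sup>2 / c i) * (\<Sum>j=1..n. (weight i n j)\<^sup>2)))"
      by (simp add: norm_Kadj_basis' ennreal_mult')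
  qed
  finally show ?thesis .
qed

end

section \<open>Estimates for geometric sums and sums of powers\<close>

text \<open>The bound \<open>min 1 z\<close> is turned into a single power of \<open>z\<close> whose exponent can be chosen freely; both
  the bias and the variance are estimated in this way.\<close>

lemma power2_le_powr:
  fixes y z x :: real
  assumes "0 \<le> y" "y \<le> 1" "y \<le> z" "0 < z" "0 \<le> x" "x \<le> 2"
  shows "y\<^sup>2 \<le> z powr x"
proof (cases "z \<ge> 1")
  case True
  have "y\<^sup>2 \<le> 1" using assms by (simp add: power_le_one)
  also have "1 \<le> z powr x" using True assms by (simp add: ge_one_powr_ge_zero)
  finally show ?thesis .
next
  case False
  have "y\<^sup>2 \<le> z\<^sup>2" using assms by (intro power_mono) auto
  also have "z\<^sup>2 = z powr 2" using assms by (simp add: powr_numeral)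
  also have "\<dots> \<le> z powr x" using False assms by (intro powr_mono') auto
  finally show ?thesis .
qed

text \<open>Telescoping with \<open>i powr - \<delta> - (i + 1) powr - \<delta> \<ge> \<delta> * (i + 1) powr (- 1 - \<delta>)\<close>. The explicit
  dependence on \<open>\<delta>\<close> is what later becomes the power of \<open>\<theta>\<close> in the rate.\<close>

lemma sum_powr_le:
  fixes \<delta> :: real
  assumes "\<delta> > 0"
  shows "(\<Sum>i<n. real (Suc i) powr (- 1 - \<delta>)) \<le> 1 + 1 / \<delta>"
proof -
  have step: "real (Suc i) powr (- 1 - \<delta>) \<le> (real i powr - \<delta> - real (Suc i) powr - \<delta>) / \<delta>"
    if "i \<ge> 1" for i
  proof -
    define u where "u = real i / real (Suc i)"
    have u: "0 < u" "1 - u = 1 / real (Suc i)" using that by (auto simp: u_def field_simps)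
    have "1 + \<delta> * (1 - u) \<le> 1 + (- \<delta> * ln u)"
      using ln_le_minus_one[OF u(1)] mult_left_mono[of "1 - u" "- ln u" \<delta>] assms by simp
    also have "\<dots> \<le> exp (- \<delta> * ln u)" by (rule exp_ge_add_one_self)
    also have "\<dots> = u powr - \<delta>" using u by (simp add: powr_def)
    finally have "(1 + \<delta> * (1 - u)) * real (Suc i) powr - \<delta> \<le> u powr - \<delta> * real (Suc i) powr - \<delta>"
      by (intro mult_right_mono) auto
    also have "u powr - \<delta> * real (Suc i) powr - \<delta> = real i powr - \<delta>"
      using u by (subst powr_mult[symmetric]) (auto simp: u_def)
    finally have "\<delta> * (real (Suc i) powr - \<delta> / real (Suc i)) \<le> real i powr - \<delta> - real (Suc i) powr - \<delta>"
      by (simp only: u(2)) (simp add: algebra_simps)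
    moreover have "real (Suc i) powr (- 1 - \<delta>) = real (Suc i) powr - \<delta> / real (Suc i)"
    proof -
      have "- 1 - \<delta> = - \<delta> - 1" by simp
      then show ?thesis by (simp only: powr_diff) simp
    qed
    ultimately show ?thesis using assms by (simp add: pos_le_divide_eq mult.commute)
  qed
  have partial: "(\<Sum>i<Suc m. real (Suc i) powr (- 1 - \<delta>)) \<le> 1 + (1 - real (Suc m) powr - \<delta>) / \<delta>" for m
  proof (induction m)
    case (Suc m)
    have "(\<Sum>i<Suc (Suc m). real (Suc i) powr (- 1 - \<delta>))
        \<le> 1 + (1 - real (Suc m) powr - \<delta>) / \<delta> + (real (Suc m) powr - \<delta> - real (Suc (Suc m)) powr - \<delta>) / \<delta>"
      using Suc.IH step[of "Suc m"] by (simp only: sum.lessThan_Suc[of _ "Suc m"]) auto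
    then show ?case using assms by (simp add: diff_divide_distrib)
  qed simp
  show ?thesis
  proof (cases n)
    case (Suc m)
    have "1 + (1 - real (Suc m) powr - \<delta>) / \<delta> \<le> 1 + 1 / \<delta>"
      using assms by (intro add_left_mono divide_right_mono) auto
    with partial[of m] show ?thesis unfolding Suc by (rule order_trans)
  qed (use assms in simp)
qed

lemma summable_powr_shift:
  assumes "\<delta> > (0::real)"
  shows "summable (\<lambda>i. real (Suc i) powr (- 1 - \<delta>))"
    and "(\<Sum>i. real (Suc i) powr (- 1 - \<delta>)) \<le> 1 + 1 / \<delta>"
proof -
  show 1: "summable (\<lambda>i. real (Suc i) powr (- 1 - \<delta>))"
    by (rule bounded_imp_summable[where B="1 + 1 / \<delta>"])
      (use sum_powr_le[OF assms] in \<open>auto simp: lessThan_Suc_atMost[symmetric] simp del: sum.lessThan_Suc\<close>)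
  show "(\<Sum>i. real (Suc i) powr (- 1 - \<delta>)) \<le> 1 + 1 / \<delta>"
    by (rule suminf_le_const[OF 1]) (rule sum_powr_le[OF assms])
qed

context diagonal_inverse_problem begin

text \<open>The average of the powers of \<open>r\<close> is at most \<open>1\<close> and at most \<open>r / (n (1 - r)) = 1 / (N lam)\<close>, where
  \<open>N = n / \<alpha>\<close> is the effective amount of data.\<close>

lemma decay_sq_le:
  assumes n: "n \<ge> 1" and N: "N = real n / \<alpha>" and \<tau>: "0 \<le> \<tau>" "\<tau> \<le> 1"
  shows "(decay i n)\<^sup>2 \<le> (N * lam i) powr (- (2 * \<tau>))"
proof -
  note rb = r_bounds[of i] and l = lam_pos[of i]
  have pos: "N * lam i > 0" using n N \<alpha>_pos l by simp
  have 0: "0 \<le> decay i n" unfolding decay_def using rb by (intro divide_nonneg_nonneg sum_nonneg) auto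
  have "(\<Sum>k=1..n. r i ^ k) \<le> real n"
    using sum_bounded_above[of "{1..n}" "\<lambda>k. r i ^ k" 1] rb by (simp add: power_le_one)
  then have 1: "decay i n \<le> 1" unfolding decay_def using n by simp
  have geo: "(1 - y) * (\<Sum>k=1..m. y ^ k) = y - y ^ Suc m" for y :: real and m
    by (induction m) (simp, simp add: distrib_left, simp add: algebra_simps)
  have "(1 - r i) * (\<Sum>k=1..n. r i ^ k) = r i - r i ^ Suc n"
    by (rule geo)
  also have "\<dots> \<le> r i" using rb by simp
  finally have "(\<Sum>k=1..n. r i ^ k) \<le> r i / (1 - r i)"
    using rb by (simp add: pos_le_divide_eq mult.commute)
  also have "r i / (1 - r i) = \<alpha> / lam i"
    using \<alpha>_pos l by (simp add: one_minus_r) (simp add: r_def)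
  finally have "decay i n \<le> \<alpha> / lam i / real n"
    unfolding decay_def by (intro divide_right_mono) auto
  also have "\<dots> = inverse (N * lam i)" unfolding N by (simp add: divide_simps mult_ac)
  finally have "(decay i n)\<^sup>2 \<le> inverse (N * lam i) powr (2 * \<tau>)"
    using 0 1 pos \<tau> by (intro power2_le_powr) (auto simp del: inverse_mult_distrib)
  then show ?thesis using pos by (simp only: powr_minus inverse_powr)
qed

text \<open>Each geometric sum \<open>W\<close> is at most \<open>1 / (1 - r)\<close> and has at most \<open>n\<close> terms bounded by \<open>1\<close>, so that
  \<open>(1 - r) * W\<close> is at most \<open>1\<close> and at most \<open>n * (1 - r) \<le> N * lam\<close>.\<close>

lemma sum_weight_sq_le:
  assumes n: "n \<ge> 1" and N: "N = real n / \<alpha>" and x: "0 \<le> x" "x \<le> 2"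
  shows "(1 - r i)\<^sup>2 * (\<Sum>j=1..n. (weight i n j)\<^sup>2) \<le> (N * lam i) powr x / real n"
proof -
  note rb = r_bounds[of i] and l = lam_pos[of i]
  have pos: "N * lam i > 0" using n N \<alpha>_pos l by simp
  have "((1 - r i) * weight i n j)\<^sup>2 \<le> (N * lam i) powr x / (real n)\<^sup>2" if j: "j \<in> {1..n}" for j
  proof -
    define W where "W = (\<Sum>k=j..n. r i ^ (k - j))"
    have W0: "0 \<le> W" unfolding W_def using rb by (intro sum_nonneg) auto
    have "W = (\<Sum>k<Suc (n - j). r i ^ k)"
      unfolding W_def by (rule sum.reindex_bij_witness[of _ "\<lambda>k. k + j" "\<lambda>k. k - j"]) (use j in auto)
    then have "(1 - r i) * W = 1 - r i ^ Suc (n - j)"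
      using rb by (simp only: sum_gp_strict) simp
    then have 1: "(1 - r i) * W \<le> 1" using rb by simp
    have "W \<le> real (card {j..n}) * 1"
      unfolding W_def by (rule sum_bounded_above) (use rb in \<open>auto intro: power_le_one\<close>)
    then have "W \<le> real n" using j by auto
    moreover have "1 - r i \<le> lam i / \<alpha>"
      unfolding one_minus_r using \<alpha>_pos l by (intro divide_left_mono) auto
    ultimately have "(1 - r i) * W \<le> lam i / \<alpha> * real n"
      using rb W0 l \<alpha>_pos by (intro mult_mono) auto
    also have "\<dots> = N * lam i" by (simp add: N)
    finally have "((1 - r i) * W)\<^sup>2 \<le> (N * lam i) powr x"
      using 1 W0 rb pos x by (intro power2_le_powr) auto
    moreover have "(1 - r i) * weight i n j = (1 - r i) * W / real n"
      by (simp add: weight_def W_def)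
    ultimately show ?thesis by (simp add: power_divide divide_right_mono)
  qed
  then have "(\<Sum>j=1..n. ((1 - r i) * weight i n j)\<^sup>2) \<le> real (card {1..n}) * ((N * lam i) powr x / (real n)\<^sup>2)"
    by (rule sum_bounded_above)
  also have "\<dots> = (N * lam i) powr x / real n" using n by (simp add: power2_eq_square)
  finally show ?thesis by (simp only: power_mult_distrib sum_distrib_left)
qed

lemma error_term_le:
  assumes n: "n \<ge> 1" and N: "N = real n / \<alpha>" and \<tau>: "0 \<le> \<tau>" "\<tau> \<le> 1" and x: "0 \<le> x" "x \<le> 2"
  shows "s i powr t * ((decay i n * b)\<^sup>2 + \<gamma>\<^sup>2 * ((1 - r i)\<^sup>2 / c i) * (\<Sum>j=1..n. (weight i n j)\<^sup>2))
    \<le> N powr (- (2 * \<tau>)) * (s i powr t * lam i powr (- (2 * \<tau>)) * b\<^sup>2)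
      + \<gamma>\<^sup>2 * (N powr x / real n) * (s i powr t * lam i powr x / c i)"
proof -
  have N0: "N > 0" using n N \<alpha>_pos by simp
  note l = lam_pos[of i] and c = c_pos[of i]
  have "(decay i n * b)\<^sup>2 \<le> (N * lam i) powr (- (2 * \<tau>)) * b\<^sup>2"
    unfolding power_mult_distrib by (intro mult_right_mono decay_sq_le[OF n N \<tau>]) auto
  moreover have "\<gamma>\<^sup>2 * ((1 - r i)\<^sup>2 / c i) * (\<Sum>j=1..n. (weight i n j)\<^sup>2)
      \<le> \<gamma>\<^sup>2 * ((N * lam i) powr x / real n / c i)"
    using mult_left_mono[OF divide_right_mono[OF sum_weight_sq_le[OF n N x, of i], of "c i"], of "\<gamma>\<^sup>2"] c by simp
  ultimately have "s i powr t * ((decay i n * b)\<^sup>2 + \<gamma>\<^sup>2 * ((1 - r i)\<^sup>2 / c i) * (\<Sum>j=1..n. (weight i n j)\<^sup>2))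
      \<le> s i powr t * ((N * lam i) powr (- (2 * \<tau>)) * b\<^sup>2 + \<gamma>\<^sup>2 * ((N * lam i) powr x / real n / c i))"
    by (intro mult_left_mono add_mono) auto
  also have "\<dots> = N powr (- (2 * \<tau>)) * (s i powr t * lam i powr (- (2 * \<tau>)) * b\<^sup>2)
      + \<gamma>\<^sup>2 * (N powr x / real n) * (s i powr t * lam i powr x / c i)"
    using N0 l by (simp add: powr_mult algebra_simps)
  finally show ?thesis .
qed

end

text \<open>Two-sided comparability is needed here: \<open>\<sigma> a\<^sup>2\<close> enters with a negative exponent in the bias and
  with a positive one in the variance. The constant \<open>Cv\<close> is uniform in \<open>x \<in> [0, 1]\<close> because \<open>x\<close> will
  depend on \<open>\<theta>\<close>.\<close>

lemma comparable_powr_weights: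
  fixes \<sigma> a :: "nat \<Rightarrow> real"
  assumes \<sigma>: "comparable \<sigma> (\<lambda>i. real i powr (- 1 - 2*\<epsilon>))" and a: "comparable a (\<lambda>i. real i powr (- p))"
    and t: "t \<ge> 0" and \<tau>: "\<tau> \<ge> 0"
    and q: "q = 1 + 2*\<epsilon> + 2*p" and T: "T = t * (1 + 2*\<epsilon>)"
  obtains Cb Cv where "Cb > 0" "Cv > 0"
    and "\<And>i. \<sigma> (Suc i) powr t * (\<sigma> (Suc i) * (a (Suc i))\<^sup>2) powr (- (2 * \<tau>)) \<le> Cb * real (Suc i) powr (2 * q * \<tau> - T)"
    and "\<And>i x. 0 \<le> x \<Longrightarrow> x \<le> 1 \<Longrightarrow>
      \<sigma> (Suc i) powr t * (\<sigma> (Suc i) * (a (Suc i))\<^sup>2) powr x / (a (Suc i))\<^sup>2 \<le> Cv * real (Suc i) powr (2 * p - T - q * x)"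
proof -
  obtain c1 c2 where c12: "c1 > 0" "c2 > 0"
    and s: "\<And>i. i \<ge> 1 \<Longrightarrow> c1 * real i powr (- 1 - 2*\<epsilon>) \<le> \<sigma> i \<and> \<sigma> i \<le> c2 * real i powr (- 1 - 2*\<epsilon>)"
    using \<sigma> unfolding comparable_def by blast
  obtain c3 c4 where c34: "c3 > 0" "c4 > 0"
    and aa: "\<And>i. i \<ge> 1 \<Longrightarrow> c3 * real i powr (- p) \<le> a i \<and> a i \<le> c4 * real i powr (- p)"
    using a unfolding comparable_def by blast
  let ?Cb = "c2 powr t * (c1 * c3\<^sup>2) powr (- (2 * \<tau>))"
  let ?Cv = "c2 powr t * max 1 (c2 * c4\<^sup>2) / c3\<^sup>2"
  have asq: "c3\<^sup>2 * real (Suc i) powr (- 2*p) \<le> (a (Suc i))\<^sup>2" "(a (Suc i))\<^sup>2 \<le> c4\<^sup>2 * real (Suc i) powr (- 2*p)" for i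
  proof -
    have e: "(real (Suc i) powr (- p))\<^sup>2 = real (Suc i) powr (- 2*p)"
      by (simp add: power2_eq_square flip: powr_add)
    have "0 \<le> c3 * real (Suc i) powr (- p)" using c34 by simp
    with aa[of "Suc i"] have "(c3 * real (Suc i) powr (- p))\<^sup>2 \<le> (a (Suc i))\<^sup>2"
      and "(a (Suc i))\<^sup>2 \<le> (c4 * real (Suc i) powr (- p))\<^sup>2" by (auto intro!: power_mono)
    then show "c3\<^sup>2 * real (Suc i) powr (- 2*p) \<le> (a (Suc i))\<^sup>2" "(a (Suc i))\<^sup>2 \<le> c4\<^sup>2 * real (Suc i) powr (- 2*p)"
      unfolding power_mult_distrib e by auto
  qed
  have sp: "\<sigma> (Suc i) > 0" for i
    using s[of "Suc i"] c12 by (auto intro: less_le_trans[rotated])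
  have lower: "(c1 * c3\<^sup>2) * real (Suc i) powr (- q) \<le> \<sigma> (Suc i) * (a (Suc i))\<^sup>2"
    and upper: "\<sigma> (Suc i) * (a (Suc i))\<^sup>2 \<le> (c2 * c4\<^sup>2) * real (Suc i) powr (- q)" for i
  proof -
    have e: "real (Suc i) powr (- q) = real (Suc i) powr (- 1 - 2*\<epsilon>) * real (Suc i) powr (- 2*p)"
      by (simp add: q flip: powr_add)
    have "(c1 * real (Suc i) powr (- 1 - 2*\<epsilon>)) * (c3\<^sup>2 * real (Suc i) powr (- 2*p)) \<le> \<sigma> (Suc i) * (a (Suc i))\<^sup>2"
      using s[of "Suc i"] asq[of i] c12 sp[of i] by (intro mult_mono) auto
    then show "(c1 * c3\<^sup>2) * real (Suc i) powr (- q) \<le> \<sigma> (Suc i) * (a (Suc i))\<^sup>2"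
      unfolding e by (simp add: mult_ac)
    have "\<sigma> (Suc i) * (a (Suc i))\<^sup>2 \<le> (c2 * real (Suc i) powr (- 1 - 2*\<epsilon>)) * (c4\<^sup>2 * real (Suc i) powr (- 2*p))"
      using s[of "Suc i"] asq[of i] c12 sp[of i] by (intro mult_mono) auto
    then show "\<sigma> (Suc i) * (a (Suc i))\<^sup>2 \<le> (c2 * c4\<^sup>2) * real (Suc i) powr (- q)"
      unfolding e by (simp add: mult_ac)
  qed
  have st: "\<sigma> (Suc i) powr t \<le> c2 powr t * real (Suc i) powr (- T)" for i
  proof -
    have "\<sigma> (Suc i) powr t \<le> (c2 * real (Suc i) powr (- 1 - 2*\<epsilon>)) powr t"
      using s[of "Suc i"] sp[of i] t by (intro powr_mono2) auto
    also have "\<dots> = c2 powr t * real (Suc i) powr (- T)"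
      using c12 by (simp add: powr_mult powr_powr T algebra_simps)
    finally show ?thesis .
  qed
  show thesis
  proof (rule that[of ?Cb ?Cv])
    show "?Cb > 0" "?Cv > 0" using c12 c34 by auto
    fix i :: nat
    let ?l = "\<sigma> (Suc i) * (a (Suc i))\<^sup>2"
    have "?l powr (- (2 * \<tau>)) \<le> ((c1 * c3\<^sup>2) * real (Suc i) powr (- q)) powr (- (2 * \<tau>))"
      using lower[of i] c12 c34 \<tau> by (intro powr_mono2') auto
    also have "\<dots> = (c1 * c3\<^sup>2) powr (- (2 * \<tau>)) * real (Suc i) powr (2 * q * \<tau>)"
      using c12 c34 by (simp add: powr_mult powr_powr mult_ac)
    finally have "\<sigma> (Suc i) powr t * ?l powr (- (2 * \<tau>))
        \<le> (c2 powr t * real (Suc i) powr (- T)) * ((c1 * c3\<^sup>2) powr (- (2 * \<tau>)) * real (Suc i) powr (2 * q * \<tau>))"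
      using st[of i] by (intro mult_mono) auto
    also have "\<dots> = ?Cb * (real (Suc i) powr (- T) * real (Suc i) powr (2 * q * \<tau>))" by (simp only: mult_ac)
    also have "\<dots> = ?Cb * real (Suc i) powr (2 * q * \<tau> - T)" by (simp flip: powr_add)
    finally show "\<sigma> (Suc i) powr t * ?l powr (- (2 * \<tau>)) \<le> ?Cb * real (Suc i) powr (2 * q * \<tau> - T)" .
    fix x :: real assume x: "0 \<le> x" "x \<le> 1"
    have "?l powr x \<le> ((c2 * c4\<^sup>2) * real (Suc i) powr (- q)) powr x"
      using upper[of i] sp[of i] x by (intro powr_mono2) auto
    also have "\<dots> = (c2 * c4\<^sup>2) powr x * real (Suc i) powr (- q * x)"
      using c12 c34 by (simp add: powr_mult powr_powr)
    also have "\<dots> \<le> max 1 (c2 * c4\<^sup>2) * real (Suc i) powr (- q * x)"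
    proof (intro mult_right_mono)
      have "(c2 * c4\<^sup>2) powr x \<le> max 1 (c2 * c4\<^sup>2) powr x" using c12 c34 x by (intro powr_mono2) auto
      also have "\<dots> \<le> max 1 (c2 * c4\<^sup>2) powr 1" using x by (intro powr_mono) auto
      finally show "(c2 * c4\<^sup>2) powr x \<le> max 1 (c2 * c4\<^sup>2)" by (simp add: max_def split: if_splits)
    qed simp
    finally have 1: "?l powr x \<le> max 1 (c2 * c4\<^sup>2) * real (Suc i) powr (- q * x)" .
    have 2: "\<sigma> (Suc i) powr t * ?l powr x
        \<le> (c2 powr t * real (Suc i) powr (- T)) * (max 1 (c2 * c4\<^sup>2) * real (Suc i) powr (- q * x))"
      using st[of i] 1 by (intro mult_mono) auto
    have "\<sigma> (Suc i) powr t * ?l powr x / (a (Suc i))\<^sup>2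
        \<le> (c2 powr t * real (Suc i) powr (- T)) * (max 1 (c2 * c4\<^sup>2) * real (Suc i) powr (- q * x))
          / (c3\<^sup>2 * real (Suc i) powr (- 2*p))"
      by (rule frac_le[OF _ 2 _ asq(1)]) (use c34 in auto)
    also have "\<dots> = ?Cv * (real (Suc i) powr (- T) * real (Suc i) powr (- q * x) * inverse (real (Suc i) powr (- 2*p)))"
      by (simp only: divide_inverse inverse_mult_distrib mult_ac)
    also have "inverse (real (Suc i) powr (- 2*p)) = real (Suc i) powr (2*p)"
      by (simp flip: powr_minus)
    also have "?Cv * (real (Suc i) powr (- T) * real (Suc i) powr (- q * x) * real (Suc i) powr (2*p))
        = ?Cv * real (Suc i) powr (2 * p - T - q * x)"
      by (simp add: algebra_simps flip: powr_add)
    finally show "\<sigma> (Suc i) powr t * ?l powr x / (a (Suc i))\<^sup>2 \<le> ?Cv * real (Suc i) powr (2 * p - T - q * x)" .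
  qed
qed

section \<open>The mean squared error\<close>

lemma compact_operator_bounded_linear:
  assumes "compact_operator A"
  shows "bounded_linear A"
proof -
  have lin: "linear A" and "compact (closure (A ` cball 0 1))"
    using assms unfolding compact_operator_def by auto
  then have "bounded (A ` cball 0 1)"
    by (meson bounded_subset closure_subset compact_imp_bounded)
  then obtain C where C: "\<And>x. norm x \<le> 1 \<Longrightarrow> norm (A x) \<le> C"
    unfolding bounded_iff by (auto simp: cball_def)
  have "norm (A x) \<le> norm x * C" for x
  proof (cases "x = 0")
    case True
    then show ?thesis using linear_0[OF lin] by simp
  next
    case False
    have "A x = norm x *\<^sub>R A ((1 / norm x) *\<^sub>R x)"
      using False by (simp add: linear_cmul[OF lin])
    moreover have "norm (A ((1 / norm x) *\<^sub>R x)) \<le> C" using False by (intro C) simp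
    ultimately show ?thesis by (metis norm_scaleR abs_norm_cancel mult_left_mono norm_ge_zero)
  qed
  then show ?thesis
    using lin by (intro bounded_linear_intro[where K=C]) (auto simp: linear_add linear_cmul)
qed

lemma orthonormal_basis_hilbert_basis:
  assumes "orthonormal_basis \<phi>"
  shows "hilbert_basis (\<lambda>i. \<phi> (Suc i))"
proof
  show "\<phi> (Suc i) \<bullet> \<phi> (Suc j) = (if i = j then 1 else 0)" for i j
    using assms unfolding orthonormal_basis_def by simp
  have "range (\<lambda>i. \<phi> (Suc i)) = \<phi> ` {1..}"
    unfolding image_image[of \<phi> Suc UNIV, symmetric] by (auto simp: image_def Suc_le_eq gr0_conv_Suc)
  then show "closure (span (range (\<lambda>i. \<phi> (Suc i)))) = UNIV"
    using assms unfolding orthonormal_basis_def by simp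
qed

lemma comparable_pos:
  assumes "comparable f (\<lambda>i. real i powr b)"
  shows "f (Suc i) > 0"
proof -
  obtain c where "c > 0" "\<And>i. i \<ge> 1 \<Longrightarrow> c * real i powr b \<le> f i"
    using assms unfolding comparable_def by blast
  from this(2)[of "Suc i"] this(1) show ?thesis by (auto intro: less_le_trans[rotated])
qed

text \<open>With \<open>\<alpha> = n / N\<close>, the exponents \<open>\<tau>\<close> and \<open>x\<close> are free parameters of the bias and of the variance.
  The condition on \<open>\<tau>\<close> lets the smoothness of \<open>d\<close> absorb the growth of \<open>lam powr (- 2 * \<tau>)\<close>, and the
  condition on \<open>x\<close> makes the variances summable, with sum of order \<open>1 + 1 / \<delta>\<close>.\<close>

lemma mean_sq_error_le:
  fixes A :: "'x::{real_inner,banach,second_countable_topology} \<Rightarrow> 'y::real_inner"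
    and \<phi> :: "nat \<Rightarrow> 'x" and \<sigma> a :: "nat \<Rightarrow> real"
  assumes A: "compact_operator A"
    and \<gamma>: "\<gamma> > 0"
    and basis: "orthonormal_basis \<phi>"
    and eig: "\<forall>i\<ge>1. adjoint A (A (\<phi> i)) = (a i)\<^sup>2 *\<^sub>R \<phi> i"
    and \<epsilon>: "\<epsilon> > 0" and p: "p > 0"
    and \<sigma>: "comparable \<sigma> (\<lambda>i. real i powr (- 1 - 2*\<epsilon>))"
    and a: "comparable a (\<lambda>i. real i powr (- p))"
    and d: "summable (\<lambda>i. real (Suc i) powr (2*\<beta>) * \<bar>d \<bullet> \<phi> (Suc i)\<bar>\<^sup>2)"
    and t: "t \<ge> 0"
    and q: "q = 1 + 2*\<epsilon> + 2*p" and T: "T = t * (1 + 2*\<epsilon>)"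
    and \<tau>: "0 \<le> \<tau>" "\<tau> \<le> 1" "2 * q * \<tau> \<le> T + 2 * \<beta>"
  obtains C where "C > 0"
    and "\<And>n N x \<delta> M \<eta> u0 udag. n \<ge> 1 \<Longrightarrow> N > 0 \<Longrightarrow> 0 \<le> x \<Longrightarrow> x \<le> 1 \<Longrightarrow> \<delta> > 0 \<Longrightarrow>
      1 + \<delta> \<le> T - 2 * p + q * x \<Longrightarrow> iid_white_noise (M :: 'w measure) \<gamma> \<eta> \<Longrightarrow> u0 - udag = d \<Longrightarrow>
      mean_sq_error M A \<phi> \<sigma> \<eta> u0 udag t (real n / N) n
        \<le> ennreal (C * (N powr (- (2 * \<tau>)) + N powr x / real n * (1 + 1 / \<delta>)))"
proof -
  obtain Cb Cv where Cb: "Cb > 0" and Cv: "Cv > 0"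
    and bias: "\<And>i. \<sigma> (Suc i) powr t * (\<sigma> (Suc i) * (a (Suc i))\<^sup>2) powr (- (2 * \<tau>)) \<le> Cb * real (Suc i) powr (2 * q * \<tau> - T)"
    and var: "\<And>i x. 0 \<le> x \<Longrightarrow> x \<le> 1 \<Longrightarrow>
      \<sigma> (Suc i) powr t * (\<sigma> (Suc i) * (a (Suc i))\<^sup>2) powr x / (a (Suc i))\<^sup>2 \<le> Cv * real (Suc i) powr (2 * p - T - q * x)"
    using comparable_powr_weights[OF \<sigma> a t \<tau>(1) q T] by metis
  let ?D = "\<lambda>i. real (Suc i) powr (2*\<beta>) * \<bar>d \<bullet> \<phi> (Suc i)\<bar>\<^sup>2"
  define C where "C = Cb * suminf ?D + \<gamma>\<^sup>2 * Cv"
  have D0: "suminf ?D \<ge> 0" by (rule suminf_nonneg[OF d]) simp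
  have "C > 0" unfolding C_def using Cb Cv \<gamma> D0 by (intro add_nonneg_pos) auto
  moreover have "mean_sq_error M A \<phi> \<sigma> \<eta> u0 udag t (real n / N) n
        \<le> ennreal (C * (N powr (- (2 * \<tau>)) + N powr x / real n * (1 + 1 / \<delta>)))"
    if n: "n \<ge> 1" and N: "N > 0" and x: "0 \<le> x" "x \<le> 1" and \<delta>: "\<delta> > 0" "1 + \<delta> \<le> T - 2 * p + q * x"
      and iid: "iid_white_noise M \<gamma> \<eta>" and u0: "u0 - udag = d"
    for n N x \<delta> and M :: "'w measure" and \<eta> u0 udag
  proof -
    interpret diagonal_inverse_problem "\<lambda>i. \<phi> (Suc i)" A "\<lambda>i. \<sigma> (Suc i)" "\<lambda>i. (a (Suc i))\<^sup>2" "real n / N"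
    proof (intro diagonal_inverse_problem.intro diagonal_inverse_problem_axioms.intro)
      show "hilbert_basis (\<lambda>i. \<phi> (Suc i))" by (rule orthonormal_basis_hilbert_basis[OF basis])
      show "bounded_linear A" by (rule compact_operator_bounded_linear[OF A])
      show "adjoint A (A (\<phi> (Suc i))) = (a (Suc i))\<^sup>2 *\<^sub>R \<phi> (Suc i)" for i using eig by simp
      show s: "\<sigma> (Suc i) > 0" for i by (rule comparable_pos[OF \<sigma>])
      show "(a (Suc i))\<^sup>2 > 0" for i using comparable_pos[OF a, of i] by simp
      obtain c where c: "\<And>i. i \<ge> 1 \<Longrightarrow> \<sigma> i \<le> c * real i powr (- 1 - 2*\<epsilon>)"
        using \<sigma> unfolding comparable_def by blast
      show "summable (\<lambda>i. \<sigma> (Suc i))"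
      proof (rule summable_comparison_test')
        show "summable (\<lambda>i. c * real (Suc i) powr (- 1 - 2*\<epsilon>))"
          using \<epsilon> by (intro summable_mult summable_powr_shift) simp
        show "norm (\<sigma> (Suc i)) \<le> c * real (Suc i) powr (- 1 - 2*\<epsilon>)" for i
          using c[of "Suc i"] s[of i] by simp
      qed
      obtain c' where c': "c' > 0" "\<And>i. i \<ge> 1 \<Longrightarrow> a i \<le> c' * real i powr (- p)"
        using a unfolding comparable_def by blast
      have "(a (Suc i))\<^sup>2 \<le> c'\<^sup>2" for i
      proof (rule power_mono)
        have "c' * real (Suc i) powr (- p) \<le> c' * 1"
          using c'(1) p powr_mono[of "- p" 0 "real (Suc i)"] by (intro mult_left_mono) auto
        with c'(2)[of "Suc i"] show "a (Suc i) \<le> c'" by simp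
      qed (use comparable_pos[OF a, of i] in simp)
      then show "\<exists>C. \<forall>i. (a (Suc i))\<^sup>2 \<le> C" by blast
      show "real n / N > 0" using n N by simp
    qed
    let ?z = "\<lambda>i. real (Suc i) powr (- 1 - \<delta>)"
    let ?b = "\<lambda>i. N powr (- (2 * \<tau>)) * (Cb * ?D i) + \<gamma>\<^sup>2 * (N powr x / real n) * (Cv * ?z i)"
    have power: "spectral_power \<phi> \<sigma> w = diag (\<lambda>i. \<sigma> (Suc i) powr w)" for w
      by (rule ext) (simp add: spectral_power_def diag_def)
    have "mean_sq_error M A \<phi> \<sigma> \<eta> u0 udag t (real n / N) n
      = (\<Sum>i. ennreal (\<sigma> (Suc i) powr t * ((decay i n * ((u0 - udag) \<bullet> \<phi> (Suc i)))\<^sup>2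
        + \<gamma>\<^sup>2 * ((1 - r i)\<^sup>2 / (a (Suc i))\<^sup>2) * (\<Sum>j=1..n. (weight i n j)\<^sup>2))))"
      unfolding mean_sq_error_def Let_def power by (rule nn_integral_error[OF iid \<gamma> n t])
    also have "\<dots> \<le> (\<Sum>i. ennreal (?b i))"
    proof (intro suminf_le ennreal_leI summableI)
      fix i
      have N': "N = real n / (real n / N)" using n N by simp
      have "\<sigma> (Suc i) powr t * lam i powr (- (2 * \<tau>)) \<le> Cb * real (Suc i) powr (2 * q * \<tau> - T)"
        using bias[of i] by (simp add: lam_def)
      also have "\<dots> \<le> Cb * real (Suc i) powr (2 * \<beta>)"
        using Cb \<tau>(3) by (intro mult_left_mono powr_mono) auto
      finally have 1: "\<sigma> (Suc i) powr t * lam i powr (- (2 * \<tau>)) * ((u0 - udag) \<bullet> \<phi> (Suc i))\<^sup>2 \<le> Cb * ?D i"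
        unfolding u0 by (simp add: mult_right_mono flip: mult.assoc)
      have "\<sigma> (Suc i) powr t * lam i powr x / (a (Suc i))\<^sup>2 \<le> Cv * real (Suc i) powr (2 * p - T - q * x)"
        using var[OF x, of i] by (simp add: lam_def)
      also have "\<dots> \<le> Cv * ?z i"
        using Cv \<delta>(2) by (intro mult_left_mono powr_mono) auto
      finally have 2: "\<sigma> (Suc i) powr t * lam i powr x / (a (Suc i))\<^sup>2 \<le> Cv * ?z i" .
      have "\<sigma> (Suc i) powr t * ((decay i n * ((u0 - udag) \<bullet> \<phi> (Suc i)))\<^sup>2
          + \<gamma>\<^sup>2 * ((1 - r i)\<^sup>2 / (a (Suc i))\<^sup>2) * (\<Sum>j=1..n. (weight i n j)\<^sup>2))
        \<le> N powr (- (2 * \<tau>)) * (\<sigma> (Suc i) powr t * lam i powr (- (2 * \<tau>)) * ((u0 - udag) \<bullet> \<phi> (Suc i))\<^sup>2)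
          + \<gamma>\<^sup>2 * (N powr x / real n) * (\<sigma> (Suc i) powr t * lam i powr x / (a (Suc i))\<^sup>2)"
        using x by (intro error_term_le[OF n N' \<tau>(1,2)]) auto
      also have "\<dots> \<le> ?b i"
        using 1 2 by (intro add_mono mult_left_mono) auto
      finally show "\<sigma> (Suc i) powr t * ((decay i n * ((u0 - udag) \<bullet> \<phi> (Suc i)))\<^sup>2
          + \<gamma>\<^sup>2 * ((1 - r i)\<^sup>2 / (a (Suc i))\<^sup>2) * (\<Sum>j=1..n. (weight i n j)\<^sup>2)) \<le> ?b i" .
    qed
    also have "\<dots> = ennreal (N powr (- (2 * \<tau>)) * (Cb * suminf ?D) + \<gamma>\<^sup>2 * (N powr x / real n) * (Cv * suminf ?z))"
    proof (rule suminf_ennreal_eq)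
      show "?b i \<ge> 0" for i using Cb Cv by simp
      show "?b sums (N powr (- (2 * \<tau>)) * (Cb * suminf ?D) + \<gamma>\<^sup>2 * (N powr x / real n) * (Cv * suminf ?z))"
        by (intro sums_add sums_mult summable_sums d summable_powr_shift(1) \<delta>(1))
    qed
    also have "\<dots> \<le> ennreal (C * (N powr (- (2 * \<tau>)) + N powr x / real n * (1 + 1 / \<delta>)))"
    proof (rule ennreal_leI)
      have "N powr (- (2 * \<tau>)) * (Cb * suminf ?D) + \<gamma>\<^sup>2 * (N powr x / real n) * (Cv * suminf ?z)
        \<le> N powr (- (2 * \<tau>)) * C + C * (N powr x / real n) * (1 + 1 / \<delta>)"
      proof (rule add_mono)
        show "N powr (- (2 * \<tau>)) * (Cb * suminf ?D) \<le> N powr (- (2 * \<tau>)) * C"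
          unfolding C_def using Cv by (intro mult_left_mono) auto
        have "\<gamma>\<^sup>2 * (N powr x / real n) * (Cv * suminf ?z) = \<gamma>\<^sup>2 * Cv * (N powr x / real n) * suminf ?z" by simp
        also have "\<dots> \<le> C * (N powr x / real n) * (1 + 1 / \<delta>)"
          unfolding C_def using Cb Cv D0 summable_powr_shift[OF \<delta>(1)]
          by (intro mult_mono mult_right_mono) (auto intro: suminf_nonneg)
        finally show "\<gamma>\<^sup>2 * (N powr x / real n) * (Cv * suminf ?z) \<le> C * (N powr x / real n) * (1 + 1 / \<delta>)" .
      qed
      then show "N powr (- (2 * \<tau>)) * (Cb * suminf ?D) + \<gamma>\<^sup>2 * (N powr x / real n) * (Cv * suminf ?z)
        \<le> C * (N powr (- (2 * \<tau>)) + N powr x / real n * (1 + 1 / \<delta>))"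
        by (simp add: algebra_simps)
    qed
    finally show ?thesis .
  qed
  ultimately show thesis by (rule that)
qed

section \<open>Convergence rates\<close>

theorem corollary1p9:
  fixes A :: "'x::{real_inner,banach,second_countable_topology}
              \<Rightarrow> 'y::{real_inner,banach,second_countable_topology}"
    and S :: "'x \<Rightarrow> 'x" and \<phi> :: "nat \<Rightarrow> 'x" and \<sigma> a :: "nat \<Rightarrow> real"
    and d :: 'x and \<gamma> \<epsilon> p \<beta> t :: real
  assumes "compact_operator A"
    and "self_adjoint_positive_definite S"
    and "\<gamma> > 0"
    and "orthonormal_basis \<phi>"
    and "\<forall>i\<ge>1. S (\<phi> i) = \<sigma> i *\<^sub>R \<phi> i"
    and "\<forall>i\<ge>1. adjoint A (A (\<phi> i)) = (a i)\<^sup>2 *\<^sub>R \<phi> i"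
    and "\<epsilon> > 0" and "p > 0"
    and "comparable \<sigma> (\<lambda>i. real i powr (- 1 - 2*\<epsilon>))"
    and "comparable a (\<lambda>i. real i powr (- p))"
    and "\<beta> \<ge> 0"
    and "summable (\<lambda>i. real (Suc i) powr (2*\<beta>) * \<bar>d \<bullet> \<phi> (Suc i)\<bar>\<^sup>2)"
    and "t \<ge> 0"
  shows "(tau_b \<epsilon> p \<beta> t \<le> 1 \<and> tau_v \<epsilon> p t \<le> 1 \<longrightarrow>
           (\<exists>C>0. \<forall>\<theta>\<in>{0<..1}. \<forall>n\<ge>1. \<exists>\<alpha>>0. \<forall>(M :: 'w measure) \<eta> u0 udag.
              iid_white_noise M \<gamma> \<eta> \<and> u0 - udag = d \<longrightarrow>
                mean_sq_error M A \<phi> \<sigma> \<eta> u0 udag t \<alpha> n \<le>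
                ennreal (C *
                  \<theta> powr (- ((2*\<beta> + t * (1 + 2*\<epsilon>)) /
                    (1 + 2*p + 2*\<beta> + \<theta> * (t * (1 + 2*\<epsilon>) + 2*\<epsilon>)))) *
                  real n powr (- ((t * (1 + 2*\<epsilon>) + 2*\<beta>) /
                    (1 + 2*p + 2*\<beta> + \<theta> * (t * (1 + 2*\<epsilon>) + 2*\<epsilon>)))))))
       \<and> (tau_b \<epsilon> p \<beta> t > 1 \<and> tau_v \<epsilon> p t > 1 \<longrightarrow>
           (\<exists>C>0. \<forall>n\<ge>1. \<exists>\<alpha>>0. \<forall>(M :: 'w measure) \<eta> u0 udag.
              iid_white_noise M \<gamma> \<eta> \<and> u0 - udag = d \<longrightarrow>
                mean_sq_error M A \<phi> \<sigma> \<eta> u0 udag t \<alpha> n \<le>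
                ennreal (C * real n powr (- 1))))"
proof -
  define q T where "q = 1 + 2*\<epsilon> + 2*p" and "T = t * (1 + 2*\<epsilon>)"
  note eps = \<open>\<epsilon> > 0\<close> and pp = \<open>p > 0\<close>
  have q: "q > 0" and T: "T \<ge> 0" using assms by (auto simp: q_def T_def)
  have tb: "tau_b \<epsilon> p \<beta> t = (T + 2*\<beta>) / (2 * q)" and tv: "tau_v \<epsilon> p t = (T + 2*\<epsilon>) / q"
    by (simp_all add: tau_b_def tau_v_def q_def T_def)
  have tb0: "tau_b \<epsilon> p \<beta> t \<ge> 0" and tv0: "tau_v \<epsilon> p t \<ge> 0"
    unfolding tb tv using q T assms by auto
  note error_le = mean_sq_error_le[where 'w='w, OF assms(1,3,4,6,7,8,9,10,12,13) q_def T_def]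
  show ?thesis
  proof (intro conjI impI; elim conjE)
    assume tb1: "tau_b \<epsilon> p \<beta> t \<le> 1" and tv1: "tau_v \<epsilon> p t \<le> 1"
    have tbq: "2 * q * tau_b \<epsilon> p \<beta> t = T + 2*\<beta>" and tvq: "q * tau_v \<epsilon> p t = T + 2*\<epsilon>"
      unfolding tb tv using q by auto
    obtain C where C: "C > 0"
      and bound: "\<And>n N x \<delta> M \<eta> u0 udag. n \<ge> 1 \<Longrightarrow> N > 0 \<Longrightarrow> 0 \<le> x \<Longrightarrow> x \<le> 1 \<Longrightarrow> \<delta> > 0 \<Longrightarrow>
      1 + \<delta> \<le> T - 2 * p + q * x \<Longrightarrow> iid_white_noise (M :: 'w measure) \<gamma> \<eta> \<Longrightarrow> u0 - udag = d \<Longrightarrow>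
      mean_sq_error M A \<phi> \<sigma> \<eta> u0 udag t (real n / N) n
        \<le> ennreal (C * (N powr (- (2 * tau_b \<epsilon> p \<beta> t)) + N powr x / real n * (1 + 1 / \<delta>)))"
      using error_le[OF tb0 tb1] tbq by (metis order_refl)
    define C' where "C' = C * (2 + 1 / (T + 2*\<epsilon>))"
    have "C' > 0" unfolding C'_def using C T eps by (intro mult_pos_pos add_pos_pos) auto
    moreover have "\<exists>\<alpha>>0. \<forall>(M :: 'w measure) \<eta> u0 udag.
              iid_white_noise M \<gamma> \<eta> \<and> u0 - udag = d \<longrightarrow>
                mean_sq_error M A \<phi> \<sigma> \<eta> u0 udag t \<alpha> n \<le>
                ennreal (C' *
                  \<theta> powr (- ((2*\<beta> + t * (1 + 2*\<epsilon>)) /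
                    (1 + 2*p + 2*\<beta> + \<theta> * (t * (1 + 2*\<epsilon>) + 2*\<epsilon>)))) *
                  real n powr (- ((t * (1 + 2*\<epsilon>) + 2*\<beta>) /
                    (1 + 2*p + 2*\<beta> + \<theta> * (t * (1 + 2*\<epsilon>) + 2*\<epsilon>)))))"
      if \<theta>: "\<theta> \<in> {0<..1}" and n: "n \<ge> 1" for \<theta> and n :: nat
    proof -
      \<comment> \<open>The summability margin \<open>\<delta>\<close> fixes the variance exponent \<open>x\<close>. Then \<open>2 * tau_b + x = E / q\<close>, and
        \<open>N\<close> is chosen so that the bias \<open>N powr (- 2 * tau_b)\<close> equals the variance bound \<open>N powr x / y\<close>;
        the sum of order \<open>1 / \<theta>\<close> reduces the sample size \<open>n\<close> to \<open>y = n * \<theta>\<close>.\<close>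
      define \<delta> where "\<delta> = \<theta> * (T + 2*\<epsilon>)"
      define x where "x = 1 - (1 - \<theta>) * tau_v \<epsilon> p t"
      define E where "E = 1 + 2*p + 2*\<beta> + \<delta>"
      define \<kappa> where "\<kappa> = (T + 2*\<beta>) / E"
      define y where "y = real n * \<theta>"
      define N where "N = y powr (q / E)"
      have \<delta>: "\<delta> > 0" unfolding \<delta>_def using \<theta> T eps by (intro mult_pos_pos) auto
      have E: "E > 0" unfolding E_def using \<delta> pp \<open>\<beta> \<ge> 0\<close> by linarith
      have y: "y > 0" and N: "N > 0" using n \<theta> by (auto simp: y_def N_def)
      have "(1 - \<theta>) * tau_v \<epsilon> p t \<le> 1 * 1" using \<theta> tv0 tv1 by (intro mult_mono) auto
      then have x: "0 \<le> x" "x \<le> 1" unfolding x_def using \<theta> tv0 by auto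
      have "q * x = q - (1 - \<theta>) * (q * tau_v \<epsilon> p t)" by (simp add: x_def algebra_simps)
      then have qx: "q * x = 1 + 2*p - T + \<delta>"
        unfolding tvq by (simp add: q_def \<delta>_def algebra_simps)
      then have margin: "1 + \<delta> \<le> T - 2 * p + q * x" by simp
      have "N powr (- (2 * tau_b \<epsilon> p \<beta> t)) = y powr (- ((2 * q * tau_b \<epsilon> p \<beta> t) / E))"
        unfolding N_def powr_powr by (simp add: mult_ac)
      then have 1: "N powr (- (2 * tau_b \<epsilon> p \<beta> t)) = y powr - \<kappa>" by (simp add: tbq \<kappa>_def)
      have "N powr x / y = y powr (q * x / E - 1)"
        using y unfolding N_def powr_powr by (simp add: powr_diff)
      also have "q * x / E - 1 = - \<kappa>"
        proof -
        have "1 + 2*p - T + \<delta> = E - (T + 2*\<beta>)" by (simp add: E_def)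
        then show ?thesis using E unfolding qx \<kappa>_def by (simp only: diff_divide_distrib) simp
      qed
      finally have 2: "N powr x / y = y powr - \<kappa>" .
      have "\<theta> * (1 + 1 / \<delta>) = \<theta> + 1 / (T + 2*\<epsilon>)"
        using \<theta> T eps unfolding \<delta>_def by (simp only: distrib_left[of \<theta> 1]) simp
      also have "\<dots> \<le> 1 + 1 / (T + 2*\<epsilon>)" using \<theta> by simp
      finally have "(N powr x / y) * (\<theta> * (1 + 1 / \<delta>)) \<le> (N powr x / y) * (1 + 1 / (T + 2*\<epsilon>))"
        using y by (intro mult_left_mono) auto
      moreover have "(N powr x / y) * (\<theta> * (1 + 1 / \<delta>)) = N powr x / real n * (1 + 1 / \<delta>)"
        using \<theta> by (simp add: y_def)
      ultimately have 3: "N powr x / real n * (1 + 1 / \<delta>) \<le> y powr - \<kappa> * (1 + 1 / (T + 2*\<epsilon>))"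
        unfolding 2 by simp
      have "C * (N powr (- (2 * tau_b \<epsilon> p \<beta> t)) + N powr x / real n * (1 + 1 / \<delta>))
        \<le> C * (y powr - \<kappa> + y powr - \<kappa> * (1 + 1 / (T + 2*\<epsilon>)))"
        using C 3 unfolding 1 by (intro mult_left_mono add_left_mono) auto
      also have "\<dots> = C' * y powr - \<kappa>" by (simp add: C'_def algebra_simps)
      also have "\<dots> = C' * \<theta> powr - \<kappa> * real n powr - \<kappa>"
        unfolding y_def using \<theta> by (simp add: powr_mult)
      finally have le: "C * (N powr (- (2 * tau_b \<epsilon> p \<beta> t)) + N powr x / real n * (1 + 1 / \<delta>))
        \<le> C' * \<theta> powr - \<kappa> * real n powr - \<kappa>" .
      have \<kappa>: "(2*\<beta> + t * (1 + 2*\<epsilon>)) / (1 + 2*p + 2*\<beta> + \<theta> * (t * (1 + 2*\<epsilon>) + 2*\<epsilon>)) = \<kappa>"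
        "(t * (1 + 2*\<epsilon>) + 2*\<beta>) / (1 + 2*p + 2*\<beta> + \<theta> * (t * (1 + 2*\<epsilon>) + 2*\<epsilon>)) = \<kappa>"
        by (simp_all add: \<kappa>_def E_def \<delta>_def T_def add.commute)
      show ?thesis
        unfolding \<kappa>
      proof (intro exI[of _ "real n / N"] conjI allI impI; (elim conjE)?)
        show "0 < real n / N" using n N by simp
        fix M :: "'w measure" and \<eta> :: "nat \<Rightarrow> 'y \<Rightarrow> 'w \<Rightarrow> real" and u0 udag :: 'x
        assume "iid_white_noise M \<gamma> \<eta>" "u0 - udag = d"
        from bound[OF n N x \<delta> margin this] ennreal_leI[OF le]
        show "mean_sq_error M A \<phi> \<sigma> \<eta> u0 udag t (real n / N) n \<le> ennreal (C' * \<theta> powr - \<kappa> * real n powr - \<kappa>)"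
          by (rule order_trans)
      qed
    qed
    ultimately show "\<exists>C>0. \<forall>\<theta>\<in>{0<..1}. \<forall>n\<ge>1. \<exists>\<alpha>>0. \<forall>(M :: 'w measure) \<eta> u0 udag.
              iid_white_noise M \<gamma> \<eta> \<and> u0 - udag = d \<longrightarrow>
                mean_sq_error M A \<phi> \<sigma> \<eta> u0 udag t \<alpha> n \<le>
                ennreal (C *
                  \<theta> powr (- ((2*\<beta> + t * (1 + 2*\<epsilon>)) /
                    (1 + 2*p + 2*\<beta> + \<theta> * (t * (1 + 2*\<epsilon>) + 2*\<epsilon>)))) *
                  real n powr (- ((t * (1 + 2*\<epsilon>) + 2*\<beta>) /
                    (1 + 2*p + 2*\<beta> + \<theta> * (t * (1 + 2*\<epsilon>) + 2*\<epsilon>)))))"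
      by blast
  next
    assume tb1: "tau_b \<epsilon> p \<beta> t > 1" and tv1: "tau_v \<epsilon> p t > 1"
    \<comment> \<open>The variances are already summable for \<open>x = 0\<close>, and the bias is of order \<open>N powr - 2\<close>, so \<open>N = n\<close>,
      that is \<open>\<alpha> = 1\<close>, suffices.\<close>
    define \<delta> where "\<delta> = T - 2*p - 1"
    have \<delta>: "\<delta> > 0" using tv1 q unfolding tv \<delta>_def by (simp add: q_def)
    have "2 * q * 1 \<le> T + 2*\<beta>" using tb1 q unfolding tb by simp
    from error_le[OF zero_le_one order_refl this]
    obtain C where C: "C > 0"
      and bound: "\<And>n N x \<delta> M \<eta> u0 udag. n \<ge> 1 \<Longrightarrow> N > 0 \<Longrightarrow> 0 \<le> x \<Longrightarrow> x \<le> 1 \<Longrightarrow> \<delta> > 0 \<Longrightarrow>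
      1 + \<delta> \<le> T - 2 * p + q * x \<Longrightarrow> iid_white_noise (M :: 'w measure) \<gamma> \<eta> \<Longrightarrow> u0 - udag = d \<Longrightarrow>
      mean_sq_error M A \<phi> \<sigma> \<eta> u0 udag t (real n / N) n
        \<le> ennreal (C * (N powr (- (2 * 1)) + N powr x / real n * (1 + 1 / \<delta>)))"
      by metis
    define C' where "C' = C * (2 + 1 / \<delta>)"
    have "C' > 0" unfolding C'_def using C \<delta> by (intro mult_pos_pos add_pos_pos) auto
    moreover have "mean_sq_error M A \<phi> \<sigma> \<eta> u0 udag t 1 n \<le> ennreal (C' * real n powr (- 1))"
      if n: "n \<ge> 1" and iid: "iid_white_noise M \<gamma> \<eta>" and d: "u0 - udag = d"
      for n and M :: "'w measure" and \<eta> u0 udag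
    proof -
      have n0: "real n > 0" using n by simp
      have "mean_sq_error M A \<phi> \<sigma> \<eta> u0 udag t (real n / real n) n
        \<le> ennreal (C * (real n powr (- (2 * 1)) + real n powr 0 / real n * (1 + 1 / \<delta>)))"
        by (rule bound[OF n n0 _ _ \<delta> _ iid d]) (auto simp: \<delta>_def)
      also have "\<dots> \<le> ennreal (C' * real n powr (- 1))"
      proof (rule ennreal_leI)
        have "real n powr (- (2 * 1)) \<le> real n powr (- 1)" using n by (intro powr_mono) auto
        moreover have "real n powr 0 / real n = real n powr (- 1)" using n by (simp add: powr_minus_divide)
        ultimately have "C * (real n powr (- (2 * 1)) + real n powr 0 / real n * (1 + 1 / \<delta>))
          \<le> C * (real n powr (- 1) + real n powr (- 1) * (1 + 1 / \<delta>))"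
          using C by (intro mult_left_mono add_mono) auto
        also have "\<dots> = C' * real n powr (- 1)" by (simp add: C'_def algebra_simps)
        finally show "C * (real n powr (- (2 * 1)) + real n powr 0 / real n * (1 + 1 / \<delta>)) \<le> C' * real n powr (- 1)" .
      qed
      finally show ?thesis using n by simp
    qed
    ultimately show "\<exists>C>0. \<forall>n\<ge>1. \<exists>\<alpha>>0. \<forall>(M :: 'w measure) \<eta> u0 udag.
              iid_white_noise M \<gamma> \<eta> \<and> u0 - udag = d \<longrightarrow>
                mean_sq_error M A \<phi> \<sigma> \<eta> u0 udag t \<alpha> n \<le>
                ennreal (C * real n powr (- 1))"
      using zero_less_one by blast
  qed
qed

end
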